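(* Let $n,\kappa',\delta$ be integers with $4\leq\kappa'<\delta$ and $n\geq 2\delta+4$, and let $G\in \mathcal{A}_{n}^{\kappa',\delta}$. Then $\rho(G)\leq \rho(B_{n,\delta+1}^{\kappa'})$, with equality if and only if $G\cong B_{n,\delta+1}^{\kappa'}$.
   Context: All graphs are finite, undirected and simple. The order of a graph is its number of vertices. The spectral radius $\rho(G)$ is the largest eigenvalue of the adjacency matrix of $G$. The edge connectivity of $G$ is the minimum cardinality of an edge cut of $G$. $\mathcal{A}_{n}^{\kappa',\delta}$ denotes the set of graphs of order $n$ with minimum degree (exactly) $\delta$ and edge connectivity (exactly) $\kappa'$. $K_m$ denotes the complete graph on $m$ vertices. $B_{n,\delta+1}^{i}$ denotes the graph obtained from the disjoint union $K_{\delta+1}\cup K_{n-\delta-1}$ by adding $i$ edges joining a single vertex of $K_{\delta+1}$ to $i$ distinct vertices of $K_{n-\delta-1}$ (unique up to isomorphism). *)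

theory Defs
  imports "Jordan_Normal_Form.Char_Poly"
begin

text \<open>Finite simple graphs: a vertex set together with a set of two-element subsets of it.\<close>

type_synonym 'a sgraph = "'a set \<times> 'a set set"

abbreviation verts :: "'a sgraph \<Rightarrow> 'a set" where "verts \<equiv> fst"
abbreviation edges :: "'a sgraph \<Rightarrow> 'a set set" where "edges \<equiv> snd"

definition simple_graph :: "'a sgraph \<Rightarrow> bool" where
  "simple_graph G \<longleftrightarrow> finite (verts G) \<and> (\<forall>e\<in>edges G. e \<subseteq> verts G \<and> card e = 2)"

definition graph_iso :: "'a sgraph \<Rightarrow> 'b sgraph \<Rightarrow> bool" where
  "graph_iso G H \<longleftrightarrow>
    (\<exists>f. bij_betw f (verts G) (verts H) \<and>
         (\<forall>u\<in>verts G. \<forall>v\<in>verts G. {u, v} \<in> edges G \<longleftrightarrow> {f u, f v} \<in> edges H))"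

definition vertex_degree :: "'a sgraph \<Rightarrow> 'a \<Rightarrow> nat" where
  "vertex_degree G v = card {e \<in> edges G. v \<in> e}"

definition min_degree :: "'a sgraph \<Rightarrow> nat" where
  "min_degree G = Min (vertex_degree G ` verts G)"

definition graph_connected :: "'a sgraph \<Rightarrow> bool" where
  "graph_connected G \<longleftrightarrow>
    verts G \<noteq> {} \<and> (\<forall>u\<in>verts G. \<forall>v\<in>verts G. (u, v) \<in> {(x, y). {x, y} \<in> edges G}\<^sup>*)"

definition edge_cut :: "'a sgraph \<Rightarrow> 'a set set \<Rightarrow> bool" where
  "edge_cut G F \<longleftrightarrow> F \<subseteq> edges G \<and> \<not> graph_connected (verts G, edges G - F)"

text \<open>A disconnected graph has the empty edge cut, hence edge connectivity 0.  The minimum is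
  meaningful only for graphs with at least two vertices: a single vertex has no edge cut.\<close>

definition edge_connectivity :: "'a sgraph \<Rightarrow> nat" where
  "edge_connectivity G = Min (card ` {F. edge_cut G F})"

text \<open>The adjacency matrix depends on an ordering of the vertices, given here as a list.  Different
  orderings yield permutation-similar matrices, so the eigenvalues do not depend on the choice.\<close>

definition adjacency_matrix :: "'a sgraph \<Rightarrow> 'a list \<Rightarrow> real mat" where
  "adjacency_matrix G vs =
    mat (length vs) (length vs) (\<lambda>(i, j). if {vs ! i, vs ! j} \<in> edges G then 1 else 0)"

definition graph_eigenvalue :: "'a sgraph \<Rightarrow> real \<Rightarrow> bool" where
  "graph_eigenvalue G k \<longleftrightarrow>
    (\<exists>vs. distinct vs \<and> set vs = verts G \<and> eigenvalue (adjacency_matrix G vs) k)"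

definition graph_spectral_radius :: "'a sgraph \<Rightarrow> real" where
  "graph_spectral_radius G = Max {k. graph_eigenvalue G k}"

definition graph_class :: "nat \<Rightarrow> nat \<Rightarrow> nat \<Rightarrow> 'a sgraph set" where
  "graph_class n k d =
    {G. simple_graph G \<and> card (verts G) = n \<and> min_degree G = d \<and> edge_connectivity G = k}"

definition complete_graph :: "'a set \<Rightarrow> 'a sgraph" where
  "complete_graph S = (S, {e. e \<subseteq> S \<and> card e = 2})"

text \<open>A concrete representative of the isomorphism class \<open>B\<close> with parameters \<open>n, m, i\<close>: the two
  cliques are on \<open>{0..<m}\<close> and \<open>{m..<n}\<close>, and vertex \<open>0\<close> of the first is joined to the first \<open>i\<close>
  vertices of the second.  Meaningful for \<open>1 \<le> m\<close> and \<open>m + i \<le> n\<close>.\<close>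

definition B_graph :: "nat \<Rightarrow> nat \<Rightarrow> nat \<Rightarrow> nat sgraph" where
  "B_graph n m i =
    (verts (complete_graph {0..<m}) \<union> verts (complete_graph {m..<n}),
     edges (complete_graph {0..<m}) \<union> edges (complete_graph {m..<n}) \<union> {{0, m + j} | j. j < i})"

end

theory Submission
  imports Defs "Jordan_Normal_Form.Spectral_Radius"
begin

text \<open>
  Put \<open>m = \<delta> + 1\<close>. A minimum edge cut splits the vertices into nonempty sides \<open>S\<close> and \<open>T\<close> joined by
  exactly \<open>\<kappa>\<close> edges; as \<open>\<kappa>\<close> is less than the minimum degree, both sides have at least \<open>m\<close> vertices
  (\<open>small_cut_side_large\<close>). Let \<open>l = \<rho>(G) + 1\<close>, let \<open>x\<close> be the absolute value of an eigenvector for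
  \<open>\<rho>(G)\<close>, and let \<open>Y\<close>, \<open>Z\<close> be its sums over \<open>S\<close> and \<open>T\<close>. With \<open>d\<close> for the number of cut edges at a
  vertex, let \<open>D\<close> and \<open>E\<close> be the sums of \<open>d\<^sup>2\<close> over \<open>S\<close> and over \<open>T\<close>.

  Each side is at most a clique, so \<open>l * x v\<close> is at most the sum of \<open>x\<close> over the side of \<open>v\<close> plus its
  sum over the cut edges at \<open>v\<close>. Iterating this twice along the cut, where walks of length three are
  counted by their first and last edge, gives (\<open>walk_bound\<close>, \<open>two_block_bound\<close>)
  \<open>l * (Y\<^sup>2 + Z\<^sup>2) \<le> card S * Y\<^sup>2 + card T * Z\<^sup>2 + (2 * l * \<kappa> * Y * Z + D * Z\<^sup>2 + E * Y\<^sup>2) / (l\<^sup>2 - \<kappa>)\<close>.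
  Let \<open>S\<close> be the side with \<open>Y \<le> Z\<close>. Since \<open>D \<le> \<kappa>\<^sup>2\<close>, \<open>D + E \<le> \<kappa>\<^sup>2 + \<kappa>\<close> and \<open>card S \<ge> m\<close>, the right-hand
  side can only grow when \<open>card S\<close>, \<open>card T\<close>, \<open>D\<close>, \<open>E\<close> are replaced by \<open>m\<close>, \<open>n - m\<close>, \<open>\<kappa>\<^sup>2\<close>, \<open>\<kappa>\<close>, the
  values in the graph \<open>B\<close>. So a quadratic form in \<open>(Y, Z)\<close> that depends only on \<open>n\<close>, \<open>m\<close>, \<open>\<kappa>\<close>, \<open>l\<close> is
  nonnegative at a nonzero point.

  The roots \<open>t\<close> of the determinant \<open>secular\<close> of that form yield eigenvalues \<open>t - 1\<close> of \<open>B\<close> with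
  explicit eigenvectors (\<open>B_graph_eigenvalue\<close>). For \<open>l \<ge> n - m\<close> nonnegativity of the form makes the
  determinant nonpositive at \<open>l\<close> (\<open>secular_form\<close>), and it is positive for large \<open>l\<close>; so it has a root
  \<open>t \<ge> l\<close>, and \<open>\<rho>(G) \<le> \<rho>(B)\<close>. For \<open>l < n - m\<close> the same argument is applied at \<open>n - m\<close> instead.

  If any estimate is strict, or if \<open>Y = Z\<close>, the determinant is negative at \<open>l\<close> and \<open>\<rho>(G) < \<rho>(B)\<close>.
  Otherwise \<open>card S = m\<close>, both sides are cliques, and \<open>D = \<kappa>\<^sup>2\<close> forces all cut edges to meet in one
  vertex of \<open>S\<close>, so that \<open>G\<close> is isomorphic to \<open>B\<close> (\<open>star_cut_iso_B_graph\<close>).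
\<close>

section \<open>Eigenfunctions and the spectral radius of a graph\<close>

text \<open>The neighbours of \<open>v\<close> among the vertices of \<open>G\<close>.\<close>

definition neighbours :: "'a sgraph \<Rightarrow> 'a \<Rightarrow> 'a set" where
  "neighbours G v = {w \<in> verts G. {v, w} \<in> edges G}"

text \<open>An eigenvector of the adjacency matrix as a function on the vertices, which avoids the choice of a
  vertex ordering. The values of \<open>x\<close> outside \<open>verts G\<close> are irrelevant.\<close>

definition eigenfunction :: "'a sgraph \<Rightarrow> real \<Rightarrow> ('a \<Rightarrow> real) \<Rightarrow> bool" where
  "eigenfunction G k x \<longleftrightarrow>
    (\<exists>v\<in>verts G. x v \<noteq> 0) \<and> (\<forall>v\<in>verts G. (\<Sum>w\<in>neighbours G v. x w) = k * x v)"

lemma adjacency_matrix_carrier: "adjacency_matrix G vs \<in> carrier_mat (length vs) (length vs)"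
  by (simp add: adjacency_matrix_def)

lemma adjacency_matrix_mult_vec:
  assumes "distinct vs" "set vs = verts G" "i < length vs"
  shows "(adjacency_matrix G vs *\<^sub>v vec (length vs) (\<lambda>j. x (vs ! j))) $ i =
    (\<Sum>w\<in>neighbours G (vs ! i). x w)"
proof -
  have "(adjacency_matrix G vs *\<^sub>v vec (length vs) (\<lambda>j. x (vs ! j))) $ i =
      (\<Sum>j<length vs. if {vs ! i, vs ! j} \<in> edges G then x (vs ! j) else 0)"
    using assms(3)
    by (auto simp: adjacency_matrix_def scalar_prod_def lessThan_atLeast0 intro!: sum.cong)
  also have "\<dots> = (\<Sum>w\<in>verts G. if {vs ! i, w} \<in> edges G then x w else 0)"
    using bij_betw_nth[OF assms(1) refl, of "verts G"] assms(2)
    by (intro sum.reindex_bij_betw) auto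
  also have "\<dots> = (\<Sum>w\<in>neighbours G (vs ! i). x w)"
    unfolding neighbours_def using finite_set[of vs] assms(2) by (subst sum.inter_filter) auto
  finally show ?thesis .
qed

lemma eigenvalue_adjacency_matrix_iff:
  assumes "distinct vs" "set vs = verts G"
  shows "eigenvalue (adjacency_matrix G vs) k \<longleftrightarrow> (\<exists>x. eigenfunction G k x)"
proof
  assume "eigenvalue (adjacency_matrix G vs) k"
  then obtain v where v: "v \<in> carrier_vec (length vs)" "v \<noteq> 0\<^sub>v (length vs)"
      "adjacency_matrix G vs *\<^sub>v v = k \<cdot>\<^sub>v v"
    unfolding eigenvalue_def eigenvector_def using adjacency_matrix_carrier[of G vs] by auto
  define x where "x w = v $ (the_inv_into {..<length vs} ((!) vs) w)" for w
  have x: "x (vs ! i) = v $ i" if "i < length vs" for i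
    unfolding x_def using that assms(1) by (subst the_inv_into_f_f) (auto simp: inj_on_nth)
  have veq: "v = vec (length vs) (\<lambda>j. x (vs ! j))"
    using v(1) by (intro eq_vecI) (auto simp: x)
  have "(\<Sum>w\<in>neighbours G u. x w) = k * x u" if "u \<in> verts G" for u
  proof -
    from that assms(2) obtain i where i: "i < length vs" "u = vs ! i"
      by (metis in_set_conv_nth)
    have "(adjacency_matrix G vs *\<^sub>v v) $ i = k * x u"
      using v(1,3) i by (simp add: x)
    then show ?thesis
      using adjacency_matrix_mult_vec[OF assms i(1), of x] i veq by simp
  qed
  moreover have "\<exists>u\<in>verts G. x u \<noteq> 0"
  proof (rule ccontr)
    assume "\<not> (\<exists>u\<in>verts G. x u \<noteq> 0)"
    then have "v = 0\<^sub>v (length vs)"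
      using assms(2) nth_mem by (subst veq, intro eq_vecI) auto
    with v(2) show False by simp
  qed
  ultimately show "\<exists>x. eigenfunction G k x" unfolding eigenfunction_def by blast
next
  assume "\<exists>x. eigenfunction G k x"
  then obtain x where x: "eigenfunction G k x" by blast
  let ?v = "vec (length vs) (\<lambda>j. x (vs ! j))"
  obtain u where u: "u \<in> verts G" "x u \<noteq> 0" using x unfolding eigenfunction_def by auto
  then obtain i where "i < length vs" "u = vs ! i" using assms(2) by (metis in_set_conv_nth)
  with u have "?v $ i \<noteq> 0\<^sub>v (length vs) $ i" by simp
  then have "?v \<noteq> 0\<^sub>v (length vs)" by metis
  moreover have "adjacency_matrix G vs *\<^sub>v ?v = k \<cdot>\<^sub>v ?v"
  proof (intro eq_vecI)
    fix i assume "i < dim_vec (k \<cdot>\<^sub>v ?v)"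
    then have i: "i < length vs" by simp
    have "vs ! i \<in> verts G" using i assms(2) nth_mem by blast
    then show "(adjacency_matrix G vs *\<^sub>v ?v) $ i = (k \<cdot>\<^sub>v ?v) $ i"
      using x i by (subst adjacency_matrix_mult_vec[OF assms i]) (simp add: eigenfunction_def)
  qed (simp add: adjacency_matrix_def)
  ultimately have "eigenvector (adjacency_matrix G vs) ?v k"
    unfolding eigenvector_def using adjacency_matrix_carrier[of G vs] by simp
  then show "eigenvalue (adjacency_matrix G vs) k"
    unfolding eigenvalue_def by blast
qed

lemma graph_eigenvalue_iff:
  assumes "finite (verts G)"
  shows "graph_eigenvalue G k \<longleftrightarrow> (\<exists>x. eigenfunction G k x)"
  using eigenvalue_adjacency_matrix_iff[of _ G k] finite_distinct_list[OF assms]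
  unfolding graph_eigenvalue_def by metis

lemma finite_graph_eigenvalues:
  assumes "finite (verts G)"
  shows "finite {k. graph_eigenvalue G k}"
proof -
  obtain vs where vs: "set vs = verts G" "distinct vs" using finite_distinct_list[OF assms] by blast
  have "{k. graph_eigenvalue G k} = {k. poly (char_poly (adjacency_matrix G vs)) k = 0}"
    using graph_eigenvalue_iff[OF assms] eigenvalue_adjacency_matrix_iff[OF vs(2,1)]
      eigenvalue_root_char_poly[OF adjacency_matrix_carrier, of G vs] by simp
  moreover have "char_poly (adjacency_matrix G vs) \<noteq> 0"
    using degree_monic_char_poly[OF adjacency_matrix_carrier, of G vs] by auto
  ultimately show ?thesis using poly_roots_finite by simp
qed

lemma symmetric_real_mat_eigenvalue:
  fixes A :: "real mat"
  assumes A: "A \<in> carrier_mat n n" and "n > 0"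
    and sym: "\<And>i j. i < n \<Longrightarrow> j < n \<Longrightarrow> A $$ (i, j) = A $$ (j, i)"
  shows "\<exists>k. eigenvalue A k"
proof -
  let ?C = "map_mat complex_of_real A"
  have C: "?C \<in> carrier_mat n n" using A by simp
  obtain k where "eigenvalue ?C k"
    using spectrum_non_empty[OF C] \<open>n > 0\<close> unfolding spectrum_def by auto
  then obtain v where v: "v \<in> carrier_vec n" "v \<noteq> 0\<^sub>v n" "?C *\<^sub>v v = k \<cdot>\<^sub>v v"
    unfolding eigenvalue_def eigenvector_def using C by auto
  have ev: "(\<Sum>j<n. of_real (A $$ (i, j)) * v $ j) = k * v $ i" if "i < n" for i
  proof -
    have "(?C *\<^sub>v v) $ i = k * v $ i" using v(1,3) that by simp
    then show ?thesis using that A v(1) by (simp add: scalar_prod_def lessThan_atLeast0)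
  qed
  \<comment> \<open>For an eigenvector \<open>v\<close> of a complex eigenvalue \<open>k\<close>, symmetry makes the form \<open>q\<close> real; since it
    equals \<open>k\<close> times a positive number, \<open>k\<close> is real. Then the real and the imaginary part of \<open>v\<close>
    satisfy the eigenvalue equation, and one of them is nonzero.\<close>
  define q where "q = (\<Sum>i<n. \<Sum>j<n. cnj (v $ i) * of_real (A $$ (i, j)) * v $ j)"
  define s where "s = (\<Sum>i<n. (cmod (v $ i))\<^sup>2)"
  have "q = (\<Sum>i<n. cnj (v $ i) * (k * v $ i))"
    unfolding q_def by (intro sum.cong refl) (simp add: ev[symmetric] sum_distrib_left mult.assoc)
  also have "\<dots> = k * of_real s"
    unfolding s_def of_real_sum sum_distrib_left
    by (intro sum.cong refl) (simp add: complex_norm_square[symmetric] mult_ac)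
  finally have qk: "q = k * of_real s" .
  have "cnj q = (\<Sum>i<n. \<Sum>j<n. v $ i * of_real (A $$ (i, j)) * cnj (v $ j))"
    unfolding q_def by simp
  also have "\<dots> = (\<Sum>j<n. \<Sum>i<n. v $ i * of_real (A $$ (i, j)) * cnj (v $ j))"
    by (rule sum.swap)
  also have "\<dots> = q"
    unfolding q_def by (intro sum.cong refl) (simp add: sym mult_ac)
  finally have "cnj q = q" .
  obtain i0 where i0: "i0 < n" "v $ i0 \<noteq> 0" using v(1,2) by (metis carrier_vecD eq_vecI index_zero_vec)
  have "s > 0" unfolding s_def using i0 by (intro sum_pos2[of _ i0]) auto
  then have "cnj k = k" using \<open>cnj q = q\<close> by (simp add: qk)
  then obtain r where r: "k = of_real r" by (metis Reals_cnj_iff Reals_cases)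
  have real_ev: "eigenvalue A r" if "w \<in> carrier_vec n" "i < n" "w $ i \<noteq> 0"
    and w: "\<And>i. i < n \<Longrightarrow> (\<Sum>j<n. A $$ (i, j) * w $ j) = r * w $ i" for w i
  proof -
    have "A *\<^sub>v w = r \<cdot>\<^sub>v w"
      using A that(1) w by (intro eq_vecI) (auto simp: scalar_prod_def lessThan_atLeast0)
    moreover have "w \<noteq> 0\<^sub>v n" using that by auto
    ultimately show ?thesis
      unfolding eigenvalue_def eigenvector_def using A that(1) by auto
  qed
  show ?thesis
  proof (cases "Re (v $ i0) = 0")
    case False
    have "eigenvalue A r"
    proof (rule real_ev[of "vec n (\<lambda>i. Re (v $ i))" i0])
      fix i assume i: "i < n"
      show "(\<Sum>j<n. A $$ (i, j) * vec n (\<lambda>i. Re (v $ i)) $ j) = r * vec n (\<lambda>i. Re (v $ i)) $ i"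
        using arg_cong[OF ev[OF i], of Re] i by (simp add: r)
    qed (use False i0 in auto)
    then show ?thesis ..
  next
    case True
    have "eigenvalue A r"
    proof (rule real_ev[of "vec n (\<lambda>i. Im (v $ i))" i0])
      fix i assume i: "i < n"
      show "(\<Sum>j<n. A $$ (i, j) * vec n (\<lambda>i. Im (v $ i)) $ j) = r * vec n (\<lambda>i. Im (v $ i)) $ i"
        using arg_cong[OF ev[OF i], of Im] i by (simp add: r)
    qed (use True i0 complex_eq_iff in auto)
    then show ?thesis ..
  qed
qed

lemma graph_eigenvalue_exists:
  assumes "finite (verts G)" "verts G \<noteq> {}"
  shows "\<exists>k. graph_eigenvalue G k"
proof -
  obtain vs where vs: "set vs = verts G" "distinct vs" using finite_distinct_list[OF assms(1)] by blast
  have "\<exists>k. eigenvalue (adjacency_matrix G vs) k"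
    using assms(2) vs(1)
    by (intro symmetric_real_mat_eigenvalue[OF adjacency_matrix_carrier])
       (auto simp: adjacency_matrix_def insert_commute)
  then show ?thesis unfolding graph_eigenvalue_def using vs by blast
qed

lemma graph_spectral_radius_eigenvalue:
  assumes "finite (verts G)" "verts G \<noteq> {}"
  shows "graph_eigenvalue G (graph_spectral_radius G)"
  using Max_in[OF finite_graph_eigenvalues[OF assms(1)]] graph_eigenvalue_exists[OF assms]
  unfolding graph_spectral_radius_def by auto

lemma graph_spectral_radius_ge:
  assumes "finite (verts G)" "graph_eigenvalue G k"
  shows "k \<le> graph_spectral_radius G"
  unfolding graph_spectral_radius_def 
  using assms finite_graph_eigenvalues[OF assms(1)] by (simp add: Max_ge)

text \<open>The function is the absolute value of an eigenvector. It is nonnegative without any appeal to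
  Perron--Frobenius theory, at the price of an inequality in place of the eigenvalue equation.\<close>

lemma graph_spectral_radius_subharmonic:
  assumes "finite (verts G)" "verts G \<noteq> {}"
  obtains x where "\<And>v. x v \<ge> 0" "\<exists>v\<in>verts G. x v \<noteq> 0"
    "\<And>v. v \<in> verts G \<Longrightarrow> graph_spectral_radius G * x v \<le> (\<Sum>w\<in>neighbours G v. x w)"
proof -
  obtain x where x: "eigenfunction G (graph_spectral_radius G) x"
    using graph_spectral_radius_eigenvalue[OF assms] graph_eigenvalue_iff[OF assms(1)] by blast
  have "graph_spectral_radius G * \<bar>x v\<bar> \<le> (\<Sum>w\<in>neighbours G v. \<bar>x w\<bar>)" if "v \<in> verts G" for v
  proof -
    have "graph_spectral_radius G * \<bar>x v\<bar> \<le> \<bar>graph_spectral_radius G * x v\<bar>"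
      by (simp add: abs_mult mult_right_mono)
    also have "\<dots> = \<bar>\<Sum>w\<in>neighbours G v. x w\<bar>"
      using x that unfolding eigenfunction_def by simp
    also have "\<dots> \<le> (\<Sum>w\<in>neighbours G v. \<bar>x w\<bar>)" by (rule sum_abs)
    finally show ?thesis .
  qed
  moreover have "\<exists>v\<in>verts G. \<bar>x v\<bar> \<noteq> 0" using x unfolding eigenfunction_def by simp
  ultimately show ?thesis using that[of "\<lambda>v. \<bar>x v\<bar>"] by simp
qed

lemma eigenfunction_pullback:
  assumes "bij_betw f (verts G) (verts H)"
    and "\<And>u v. u \<in> verts G \<Longrightarrow> v \<in> verts G \<Longrightarrow> {u, v} \<in> edges G \<longleftrightarrow> {f u, f v} \<in> edges H"
    and "eigenfunction H k x"
  shows "eigenfunction G k (x \<circ> f)"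
  unfolding eigenfunction_def
proof (intro conjI ballI)
  have im: "f ` verts G = verts H" using assms(1) by (rule bij_betw_imp_surj_on)
  show "\<exists>v\<in>verts G. (x \<circ> f) v \<noteq> 0" using assms(3) im unfolding eigenfunction_def by force
  fix v assume v: "v \<in> verts G"
  have "neighbours H (f v) = f ` neighbours G v"
    using assms(2)[OF v] v unfolding neighbours_def im[symmetric] by auto
  moreover have "inj_on f (neighbours G v)"
    using assms(1) by (auto simp: bij_betw_def neighbours_def intro: inj_on_subset)
  ultimately have "(\<Sum>w\<in>neighbours G v. (x \<circ> f) w) = (\<Sum>w\<in>neighbours H (f v). x w)"
    by (simp add: sum.reindex)
  also have "\<dots> = k * x (f v)" using assms(3) v im unfolding eigenfunction_def by blast
  finally show "(\<Sum>w\<in>neighbours G v. (x \<circ> f) w) = k * (x \<circ> f) v" by simp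
qed

lemma graph_iso_sym:
  assumes "graph_iso G H"
  shows "graph_iso H G"
proof -
  obtain f where f: "bij_betw f (verts G) (verts H)"
    "\<And>u v. u \<in> verts G \<Longrightarrow> v \<in> verts G \<Longrightarrow> {u, v} \<in> edges G \<longleftrightarrow> {f u, f v} \<in> edges H"
    using assms unfolding graph_iso_def by blast
  let ?g = "the_inv_into (verts G) f"
  have g: "bij_betw ?g (verts H) (verts G)" using f(1) by (rule bij_betw_the_inv_into)
  have "?g u \<in> verts G" "f (?g u) = u" if "u \<in> verts H" for u
    using that f(1) g bij_betwE f_the_inv_into_f_bij_betw by (fast, metis)
  then have "\<forall>u\<in>verts H. \<forall>v\<in>verts H. {u, v} \<in> edges H \<longleftrightarrow> {?g u, ?g v} \<in> edges G"
    using f(2) by simp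
  then show ?thesis unfolding graph_iso_def using g by blast
qed

lemma graph_iso_eigenvalue:
  assumes "finite (verts G)" "graph_iso G H" "graph_eigenvalue H k"
  shows "graph_eigenvalue G k"
proof -
  obtain f where f: "bij_betw f (verts G) (verts H)"
    "\<And>u v. u \<in> verts G \<Longrightarrow> v \<in> verts G \<Longrightarrow> {u, v} \<in> edges G \<longleftrightarrow> {f u, f v} \<in> edges H"
    using assms(2) unfolding graph_iso_def by blast
  have "finite (verts H)" using f(1) assms(1) by (simp add: bij_betw_finite)
  then obtain x where "eigenfunction H k x"
    using assms(3) by (auto simp: graph_eigenvalue_iff)
  then have "eigenfunction G k (x \<circ> f)" using f by (rule eigenfunction_pullback[rotated 2])
  then show ?thesis using assms(1) by (auto simp: graph_eigenvalue_iff)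
qed

lemma graph_iso_spectral_radius:
  assumes "finite (verts G)" "graph_iso G H"
  shows "graph_spectral_radius G = graph_spectral_radius H"
proof -
  have "finite (verts H)"
    using assms bij_betw_finite unfolding graph_iso_def by blast
  then have "graph_eigenvalue G k = graph_eigenvalue H k" for k
    using assms graph_iso_eigenvalue graph_iso_sym by metis
  then show ?thesis by (simp add: graph_spectral_radius_def)
qed

section \<open>Degree sums in bipartite graphs\<close>

text \<open>The edges between \<open>S\<close> and \<open>T\<close>, each oriented from \<open>S\<close> to \<open>T\<close>.\<close>

definition cross :: "'a sgraph \<Rightarrow> 'a set \<Rightarrow> 'a set \<Rightarrow> ('a \<times> 'a) set" where
  "cross G S T = {(i, j). i \<in> S \<and> j \<in> T \<and> {i, j} \<in> edges G}"

lemma cross_subset: "cross G S T \<subseteq> S \<times> T"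
  by (auto simp: cross_def)

lemma converse_cross: "(cross G S T)\<inverse> = cross G T S"
  by (auto simp: cross_def insert_commute)

text \<open>The sum of the squares of the left degrees of a bipartite graph \<open>P\<close>, written as a sum over edges:
  every edge contributes the degree of its left end. Equivalently (\<open>sharing_eq_card\<close>) it is the number
  of ordered pairs of edges with a common left end.\<close>

definition sharing :: "('a \<times> 'b) set \<Rightarrow> nat" where
  "sharing P = (\<Sum>(i, j)\<in>P. card (P `` {i}))"

lemma sum_relation_left:
  assumes "finite S" "finite T" "P \<subseteq> S \<times> T"
  shows "(\<Sum>(i, j)\<in>P. f i j) = (\<Sum>i\<in>S. \<Sum>j\<in>P `` {i}. f i j)"
proof -
  have "finite (P `` {i})" for i using assms finite_subset[of "P `` {i}" T] by auto
  moreover have "P = (SIGMA i:S. P `` {i})" using assms(3) by auto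
  ultimately show ?thesis using assms(1) by (subst sum.Sigma) auto
qed

lemma sum_converse: "(\<Sum>(j, i)\<in>P\<inverse>. f i j) = (\<Sum>(i, j)\<in>P. f i j)"
  by (rule sum.reindex_bij_witness[of _ prod.swap prod.swap]) auto

lemma sum_relation_right:
  assumes "finite S" "finite T" "P \<subseteq> S \<times> T"
  shows "(\<Sum>(i, j)\<in>P. f i j) = (\<Sum>j\<in>T. \<Sum>i\<in>P\<inverse> `` {j}. f i j)"
  using sum_relation_left[OF assms(2,1), of "P\<inverse>" "\<lambda>j i. f i j"] assms(3)
  by (auto simp: sum_converse)

lemma card_eq_sum_left:
  assumes "finite S" "finite T" "P \<subseteq> S \<times> T"
  shows "(\<Sum>i\<in>S. card (P `` {i})) = card P"
  using sum_relation_left[OF assms, of "\<lambda>_ _. 1::nat"] by simp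

lemma sharing_eq_card:
  assumes "finite P"
  shows "sharing P = card {(p, q). p \<in> P \<and> q \<in> P \<and> fst p = fst q}"
proof -
  have "card (P `` {i}) = card {q \<in> P. i = fst q}" for i
    by (rule bij_betw_same_card[of "Pair i"]) (auto simp: bij_betw_def inj_on_def)
  then have "sharing P = (\<Sum>p\<in>P. card {q \<in> P. fst p = fst q})"
    unfolding sharing_def by (simp add: case_prod_beta)
  also have "\<dots> = card (SIGMA p:P. {q \<in> P. fst p = fst q})"
    using assms by (subst card_SigmaI) auto
  also have "(SIGMA p:P. {q \<in> P. fst p = fst q}) = {(p, q). p \<in> P \<and> q \<in> P \<and> fst p = fst q}"
    by auto
  finally show ?thesis .
qed

lemma sharing_le:
  assumes "finite P"
  shows "sharing P \<le> (card P)\<^sup>2"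
  unfolding sharing_eq_card[OF assms] power2_eq_square card_cartesian_product[symmetric]
  using assms by (intro card_mono) auto

lemma sharing_eq_imp_star:
  assumes "finite P" "sharing P = (card P)\<^sup>2" "(i, j) \<in> P" "(i', j') \<in> P"
  shows "i = i'"
proof -
  have "{(p, q). p \<in> P \<and> q \<in> P \<and> fst p = fst q} = P \<times> P"
    using assms(1,2) unfolding sharing_eq_card[OF assms(1)] power2_eq_square
      card_cartesian_product[symmetric] by (intro card_subset_eq) auto
  then show ?thesis using assms(3,4) by fastforce
qed

text \<open>Two edges that share both ends are equal, so the pairs counted on both sides are the diagonal ones.\<close>

lemma sharing_add_converse_le:
  assumes "finite P"
  shows "sharing P + sharing (P\<inverse>) \<le> (card P)\<^sup>2 + card P"
proof -
  let ?L = "{(p, q). p \<in> P \<and> q \<in> P \<and> fst p = fst q}"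
  let ?R = "{(p, q). p \<in> P \<and> q \<in> P \<and> snd p = snd q}"
  have "?L \<subseteq> P \<times> P" "?R \<subseteq> P \<times> P" by auto
  then have fin: "finite ?L" "finite ?R" using assms finite_subset by blast+
  have "sharing (P\<inverse>) = card ?R"
    unfolding sharing_eq_card[OF iffD2[OF finite_converse assms]]
    by (intro bij_betw_same_card[of "map_prod prod.swap prod.swap"]
          bij_betwI[where g = "map_prod prod.swap prod.swap"]) auto
  then have "sharing P + sharing (P\<inverse>) = card (?L \<union> ?R) + card (?L \<inter> ?R)"
    using card_Un_Int[OF fin] sharing_eq_card[OF assms] by simp
  also have "card (?L \<union> ?R) \<le> (card P)\<^sup>2"
    unfolding power2_eq_square card_cartesian_product[symmetric]
    using assms by (intro card_mono) auto
  also have "?L \<inter> ?R = (\<lambda>p. (p, p)) ` P" by (auto simp: prod_eq_iff)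
  also have "card \<dots> = card P" by (intro card_image inj_onI) simp
  finally show ?thesis by simp
qed

section \<open>Spectral bound for a graph with a given cut\<close>

text \<open>With \<open>P\<close> as a bipartite graph, the sum on the left is the sum of \<open>y\<close> weighted by left degree. The
  estimate replaces the geometric series over all walks in \<open>P\<close> by one self-referential inequality:
  applying the hypotheses twice brings back the same sum with a factor of at most \<open>card P\<close>.\<close>

lemma walk_bound:
  fixes y z :: "'a \<Rightarrow> real" and l Y Z :: real
  assumes fin: "finite S" "finite T" and P: "P \<subseteq> S \<times> T" and "l > 0"
    and nonneg: "\<And>i. y i \<ge> 0" "\<And>j. z j \<ge> 0"
    and y: "\<And>i. i \<in> S \<Longrightarrow> l * y i \<le> Y + (\<Sum>j\<in>P `` {i}. z j)"
    and z: "\<And>j. j \<in> T \<Longrightarrow> l * z j \<le> Z + (\<Sum>i\<in>P\<inverse> `` {j}. y i)"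
  shows "(l\<^sup>2 - real (card P)) * (\<Sum>(i, j)\<in>P. y i) \<le> l * card P * Y + Z * sharing P"
proof -
  define a where "a = (\<Sum>(i, j)\<in>P. y i)"
  define d where "d i = real (card (P `` {i}))" for i
  define r where "r j = (\<Sum>i\<in>P\<inverse> `` {j}. y i)" for j
  define c where "c = (\<Sum>(i, j)\<in>P. d i * z j)"
  have r0: "r j \<ge> 0" for j unfolding r_def by (intro sum_nonneg nonneg)
  have "l * a = (\<Sum>(i, j)\<in>P. l * y i)" by (simp add: a_def sum_distrib_left case_prod_unfold)
  also have "\<dots> \<le> (\<Sum>(i, j)\<in>P. Y + (\<Sum>j\<in>P `` {i}. z j))"
    using P by (intro sum_mono) (auto intro!: y)
  also have "\<dots> = card P * Y + (\<Sum>(i, j)\<in>P. \<Sum>j\<in>P `` {i}. z j)"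
    by (simp add: case_prod_unfold sum.distrib)
  also have "(\<Sum>(i, j)\<in>P. \<Sum>j\<in>P `` {i}. z j) = c"
    unfolding c_def d_def by (simp add: sum_relation_left[OF fin P] sum_distrib_left)
  finally have a: "l * a \<le> card P * Y + c" .
  have "l * c = (\<Sum>(i, j)\<in>P. d i * (l * z j))"
    unfolding c_def sum_distrib_left by (intro sum.cong) auto
  also have "\<dots> \<le> (\<Sum>(i, j)\<in>P. d i * (Z + r j))"
    using P unfolding r_def by (intro sum_mono) (auto intro!: mult_left_mono z simp: d_def)
  also have "\<dots> = Z * sharing P + (\<Sum>(i, j)\<in>P. d i * r j)"
    by (simp add: sharing_def d_def case_prod_unfold sum.distrib sum_distrib_left algebra_simps)
  \<comment> \<open>A walk of length three is determined by its first and last edge, so dropping the condition that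
    its middle pair is an edge gives the upper bound \<open>card P * a\<close>.\<close>
  also have "(\<Sum>(i, j)\<in>P. d i * r j) \<le> (\<Sum>(i, j)\<in>S \<times> T. d i * r j)"
    using fin P r0 by (intro sum_mono2) (auto simp: d_def)
  also have "\<dots> = (\<Sum>i\<in>S. d i) * (\<Sum>j\<in>T. r j)"
    by (simp add: sum_product sum.cartesian_product)
  also have "(\<Sum>i\<in>S. d i) = card P"
    unfolding d_def using card_eq_sum_left[OF fin P] by (simp flip: of_nat_sum)
  also have "(\<Sum>j\<in>T. r j) = a"
    unfolding a_def r_def by (rule sum_relation_right[OF fin P, symmetric])
  finally have c: "l * c \<le> Z * sharing P + card P * a" by simp
  have "l * (l * a) \<le> l * (card P * Y + c)" using a \<open>l > 0\<close> by simp
  with c show ?thesis unfolding a_def[symmetric] by (simp add: algebra_simps power2_eq_square)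
qed

text \<open>Adding \<open>x v\<close> to both sides of \<open>sub\<close> completes the neighbourhood of \<open>v\<close> within \<open>S\<close> to a subset of \<open>S\<close>.\<close>

lemma row_bound:
  fixes x :: "'a \<Rightarrow> real"
  assumes G: "simple_graph G" "verts G = S \<union> T" "S \<inter> T = {}"
    and x: "\<And>v. x v \<ge> 0" and v: "v \<in> S"
    and sub: "(l - 1) * x v \<le> (\<Sum>w\<in>neighbours G v. x w)"
  shows "l * x v \<le> sum x S + (\<Sum>w\<in>cross G S T `` {v}. x w)"
    and "u \<in> S \<Longrightarrow> u \<noteq> v \<Longrightarrow> {v, u} \<notin> edges G \<Longrightarrow> x u > 0 \<Longrightarrow>
      l * x v < sum x S + (\<Sum>w\<in>cross G S T `` {v}. x w)"
proof -
  have fin: "finite S" "finite T" using G(1,2) unfolding simple_graph_def by auto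
  have loop: "{v} \<notin> edges G" using G(1) unfolding simple_graph_def by fastforce
  let ?A = "{w \<in> S. {v, w} \<in> edges G}"
  have vA: "v \<notin> ?A" using loop by simp
  have "neighbours G v = ?A \<union> cross G S T `` {v}" "?A \<inter> cross G S T `` {v} = {}"
    using G(2,3) v by (auto simp: neighbours_def cross_def)
  moreover have "finite (cross G S T `` {v})"
    using fin by (auto simp: cross_def intro: finite_subset[of _ T])
  ultimately have split: "(\<Sum>w\<in>neighbours G v. x w) = sum x ?A + (\<Sum>w\<in>cross G S T `` {v}. x w)"
    using fin by (simp add: sum.union_disjoint)
  have ins: "x v + sum x ?A = sum x (insert v ?A)" using fin vA by simp
  have "sum x (insert v ?A) \<le> sum x S" using fin v x by (intro sum_mono2) auto
  with sub split ins show "l * x v \<le> sum x S + (\<Sum>w\<in>cross G S T `` {v}. x w)"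
    by (simp add: algebra_simps)
  assume u: "u \<in> S" "u \<noteq> v" "{v, u} \<notin> edges G" "x u > 0"
  have "sum x (insert v ?A) < sum x S"
    using fin v x u by (intro sum_strict_mono2[of _ _ u]) auto
  with sub split ins show "l * x v < sum x S + (\<Sum>w\<in>cross G S T `` {v}. x w)"
    by (simp add: algebra_simps)
qed

text \<open>The inequality \<open>row_bound\<close> summed over \<open>S\<close>. Equality in the sum means equality in every row, which
  makes \<open>x\<close> positive on \<open>S\<close> and so excludes missing edges.\<close>

lemma block_bound:
  fixes x :: "'a \<Rightarrow> real"
  assumes G: "simple_graph G" "verts G = S \<union> T" "S \<inter> T = {}"
    and x: "\<And>v. x v \<ge> 0"
    and sub: "\<And>v. v \<in> S \<Longrightarrow> (l - 1) * x v \<le> (\<Sum>w\<in>neighbours G v. x w)"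
  shows "l * sum x S \<le> card S * sum x S + (\<Sum>(i, j)\<in>cross G S T. x j)"
    and "l * sum x S = card S * sum x S + (\<Sum>(i, j)\<in>cross G S T. x j) \<Longrightarrow> sum x S > 0 \<Longrightarrow> l > 0 \<Longrightarrow>
      u \<in> S \<Longrightarrow> v \<in> S \<Longrightarrow> u \<noteq> v \<Longrightarrow> {u, v} \<in> edges G"
proof -
  have fin: "finite S" "finite T" using G(1,2) unfolding simple_graph_def by auto
  let ?b = "\<lambda>v. sum x S + (\<Sum>w\<in>cross G S T `` {v}. x w)"
  have row: "l * x v \<le> ?b v" if "v \<in> S" for v by (rule row_bound[OF G x that sub[OF that]])
  have tot: "(\<Sum>v\<in>S. ?b v) = card S * sum x S + (\<Sum>(i, j)\<in>cross G S T. x j)"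
    using sum_relation_left[OF fin cross_subset, of "\<lambda>_ j. x j" G] by (simp add: sum.distrib)
  show "l * sum x S \<le> card S * sum x S + (\<Sum>(i, j)\<in>cross G S T. x j)"
    unfolding tot[symmetric] sum_distrib_left[of l] using row by (rule sum_mono)
  assume eq: "l * sum x S = card S * sum x S + (\<Sum>(i, j)\<in>cross G S T. x j)"
    and pos: "sum x S > 0" "l > 0" and uv: "u \<in> S" "v \<in> S" "u \<noteq> v"
  have "(\<Sum>v\<in>S. ?b v - l * x v) = 0"
    using eq tot by (simp add: sum_subtractf sum_distrib_left)
  then have rows: "?b v = l * x v" if "v \<in> S" for v
    using sum_nonneg_eq_0_iff[OF fin(1), of "\<lambda>v. ?b v - l * x v"] row that by fastforce
  have "?b v > 0" for v using pos sum_nonneg[of "cross G S T `` {v}" x] x by fastforce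
  then have "l * x v > 0" using rows[OF uv(2)] by metis
  then have xv: "x v > 0" using pos by (simp add: zero_less_mult_iff)
  show "{u, v} \<in> edges G"
  proof (rule ccontr)
    assume "{u, v} \<notin> edges G"
    then have "l * x u < ?b u"
      using uv xv row_bound(2)[OF G x uv(1) sub[OF uv(1)], of v] by blast
    then show False using rows[OF uv(1)] by simp
  qed
qed

text \<open>The main estimate, with \<open>l - 1\<close> in the part of the spectral radius. If it is an equality and both
  sums are positive, then both sides of the cut are cliques.\<close>

lemma two_block_bound:
  fixes x :: "'a \<Rightarrow> real" and l Y Z R :: real
  assumes G: "simple_graph G" "verts G = S \<union> T" "S \<inter> T = {}"
    and x: "\<And>v. x v \<ge> 0"
    and sub: "\<And>v. v \<in> verts G \<Longrightarrow> (l - 1) * x v \<le> (\<Sum>w\<in>neighbours G v. x w)"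
    and l: "l > 0" "l\<^sup>2 > real (card (cross G S T))"
  defines "Y \<equiv> sum x S" and "Z \<equiv> sum x T" and "P \<equiv> cross G S T"
  defines "R \<equiv> card S * Y\<^sup>2 + card T * Z\<^sup>2 +
    (2 * l * card P * Y * Z + sharing P * Z\<^sup>2 + sharing (P\<inverse>) * Y\<^sup>2) / (l\<^sup>2 - card P)"
  shows "l * (Y\<^sup>2 + Z\<^sup>2) \<le> R"
    and "l * (Y\<^sup>2 + Z\<^sup>2) = R \<Longrightarrow> Y > 0 \<Longrightarrow> Z > 0 \<Longrightarrow> u \<noteq> v \<Longrightarrow>
      u \<in> S \<and> v \<in> S \<or> u \<in> T \<and> v \<in> T \<Longrightarrow> {u, v} \<in> edges G"
proof -
  have fin: "finite S" "finite T" using G(1,2) unfolding simple_graph_def by auto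
  have G': "verts G = T \<union> S" "T \<inter> S = {}" using G(2,3) by auto
  have PS: "P \<subseteq> S \<times> T" and PT: "P\<inverse> \<subseteq> T \<times> S" unfolding P_def by (auto simp: cross_def)
  have Pc: "P\<inverse> = cross G T S" unfolding P_def by (rule converse_cross)
  define a where "a = (\<Sum>(i, j)\<in>P. x i)"
  define b where "b = (\<Sum>(i, j)\<in>P. x j)"
  have subS: "(l - 1) * x v \<le> (\<Sum>w\<in>neighbours G v. x w)" if "v \<in> S" for v using sub G(2) that by blast
  have subT: "(l - 1) * x v \<le> (\<Sum>w\<in>neighbours G v. x w)" if "v \<in> T" for v using sub G(2) that by blast
  have rowS: "l * x v \<le> Y + (\<Sum>w\<in>P `` {v}. x w)" if "v \<in> S" for v
    unfolding Y_def P_def by (rule row_bound(1)[OF G x that subS[OF that]])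
  have rowT: "l * x v \<le> Z + (\<Sum>w\<in>P\<inverse> `` {v}. x w)" if "v \<in> T" for v
    unfolding Z_def Pc by (rule row_bound(1)[OF G(1) G' x that subT[OF that]])
  have a: "(l\<^sup>2 - card P) * a \<le> l * card P * Y + Z * sharing P"
    unfolding a_def by (rule walk_bound[OF fin PS l(1) x x rowS rowT])
  have "(l\<^sup>2 - real (card (P\<inverse>))) * (\<Sum>(j, i)\<in>P\<inverse>. x j) \<le> l * card (P\<inverse>) * Z + Y * sharing (P\<inverse>)"
    by (rule walk_bound[OF fin(2,1) PT l(1) x x rowT]) (simp_all add: rowS)
  then have b: "(l\<^sup>2 - card P) * b \<le> l * card P * Z + Y * sharing (P\<inverse>)"
    unfolding b_def by (simp add: sum_converse card_inverse)
  have YZ0: "Y \<ge> 0" "Z \<ge> 0" unfolding Y_def Z_def by (intro sum_nonneg x)+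
  have bS: "l * Y \<le> card S * Y + b"
    unfolding Y_def b_def P_def by (rule block_bound(1)[OF G x subS])
  have bT: "l * Z \<le> card T * Z + a"
    using block_bound(1)[OF G(1) G' x subT] sum_converse[of "\<lambda>i j. x i" P]
    unfolding Z_def a_def Pc by simp
  have mu: "l\<^sup>2 - card P > 0" using l(2) by (simp add: P_def)
  have "(l\<^sup>2 - card P) * (Y * b + Z * a) \<le> Y * (l * card P * Z + Y * sharing (P\<inverse>)) +
      Z * (l * card P * Y + Z * sharing P)"
    using mult_left_mono[OF a YZ0(2)] mult_left_mono[OF b YZ0(1)] by (simp add: algebra_simps)
  also have "\<dots> = 2 * l * card P * Y * Z + sharing P * Z\<^sup>2 + sharing (P\<inverse>) * Y\<^sup>2"
    by (simp add: algebra_simps power2_eq_square)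
  finally have ab: "Y * b + Z * a \<le>
      (2 * l * card P * Y * Z + sharing P * Z\<^sup>2 + sharing (P\<inverse>) * Y\<^sup>2) / (l\<^sup>2 - card P)"
    using mu by (simp add: pos_le_divide_eq mult.commute)
  have m: "Y * (l * Y) \<le> Y * (card S * Y + b)" "Z * (l * Z) \<le> Z * (card T * Z + a)"
    by (intro mult_left_mono bS bT YZ0)+
  then show le: "l * (Y\<^sup>2 + Z\<^sup>2) \<le> R"
    using ab unfolding R_def by (simp add: algebra_simps power2_eq_square)
  assume eq: "l * (Y\<^sup>2 + Z\<^sup>2) = R" and pos: "Y > 0" "Z > 0" and "u \<noteq> v"
    and uv: "u \<in> S \<and> v \<in> S \<or> u \<in> T \<and> v \<in> T"
  have "Y * (l * Y) = Y * (card S * Y + b) \<and> Z * (l * Z) = Z * (card T * Z + a)"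
    using m ab eq unfolding R_def by (simp add: algebra_simps power2_eq_square)
  then have eqs: "l * Y = card S * Y + b" "l * Z = card T * Z + a" using pos by auto
  show "{u, v} \<in> edges G"
  proof (cases "u \<in> S")
    case True
    then have "v \<in> S" using uv G(3) by auto
    then show ?thesis
      using block_bound(2)[OF G x subS _ _ l(1) True _ \<open>u \<noteq> v\<close>] eqs(1) pos(1)
      unfolding Y_def b_def P_def by blast
  next
    case False
    then have "u \<in> T" "v \<in> T" using uv by auto
    then show ?thesis
      using block_bound(2)[OF G(1) G' x subT _ _ l(1) _ _ \<open>u \<noteq> v\<close>] eqs(2) pos(2)
        sum_converse[of "\<lambda>i j. x i" P]
      unfolding Z_def a_def Pc by simp
  qed
qed

section \<open>The spectral radius of the extremal graph\<close>

text \<open>The determinant of the symmetric matrix with diagonal entries \<open>m - l + k / (l\<^sup>2 - k)\<close> and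
  \<open>n - m - l + k\<^sup>2 / (l\<^sup>2 - k)\<close> and off-diagonal entry \<open>k * l / (l\<^sup>2 - k)\<close>. A nonzero vector \<open>(Y, Z)\<close> in
  its kernel gives the sums over the two cliques of an eigenvector of \<open>B_graph n m k\<close> for \<open>l - 1\<close>.\<close>

definition secular :: "nat \<Rightarrow> nat \<Rightarrow> nat \<Rightarrow> real \<Rightarrow> real" where
  "secular n m k l =
    (real m - l + k / (l\<^sup>2 - k)) * (real n - real m - l + (real k)\<^sup>2 / (l\<^sup>2 - k)) -
    (k * l / (l\<^sup>2 - k))\<^sup>2"

lemma B_graph_edge_iff:
  assumes "u < n" "v < n" "1 \<le> m" "m + k \<le> n"
  shows "{u, v} \<in> edges (B_graph n m k) \<longleftrightarrow>
    u \<noteq> v \<and> (u < m \<and> v < m \<or> m \<le> u \<and> m \<le> v \<or>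
      u = 0 \<and> m \<le> v \<and> v < m + k \<or> v = 0 \<and> m \<le> u \<and> u < m + k)"
proof -
  have "card {u, v} = 2 \<longleftrightarrow> u \<noteq> v" by (simp add: card_insert_if)
  moreover have "(\<exists>j. {u, v} = {0, m + j} \<and> j < k) \<longleftrightarrow>
      u = 0 \<and> m \<le> v \<and> v < m + k \<or> v = 0 \<and> m \<le> u \<and> u < m + k" (is "?L = ?R")
  proof
    assume ?L then show ?R by (auto simp: doubleton_eq_iff)
  next
    assume ?R
    then show ?L
    proof (elim disjE conjE)
      assume "u = 0" "m \<le> v" "v < m + k"
      then show ?L by (intro exI[of _ "v - m"]) auto
    next
      assume "v = 0" "m \<le> u" "u < m + k"
      then show ?L by (intro exI[of _ "u - m"]) auto
    qed
  qed
  ultimately show ?thesis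
    using assms unfolding B_graph_def complete_graph_def by (auto simp: insert_commute)
qed

lemma verts_B_graph: "m \<le> n \<Longrightarrow> verts (B_graph n m k) = {0..<n}"
  by (auto simp: B_graph_def complete_graph_def)

text \<open>The eigenvector is constant on the four orbits of the vertices: \<open>a\<close> at the centre of the star, \<open>c\<close>
  at its leaves, and \<open>Y / l\<close> and \<open>Z / l\<close> at the other vertices of the two cliques. The two equations
  say that its sums over the cliques are \<open>Y\<close> and \<open>Z\<close>.\<close>

lemma B_graph_eigenvalue:
  fixes l Y Z :: real
  assumes mk: "1 \<le> m" "m + k \<le> n" and l: "l > 0" "l\<^sup>2 > real k"
    and nz: "Y \<noteq> 0 \<or> Z \<noteq> 0"
    and eq: "(real m - l + k / (l\<^sup>2 - k)) * Y + (k * l / (l\<^sup>2 - k)) * Z = 0"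
      "(k * l / (l\<^sup>2 - k)) * Y + (real n - real m - l + (real k)\<^sup>2 / (l\<^sup>2 - k)) * Z = 0"
  shows "graph_eigenvalue (B_graph n m k) (l - 1)"
proof -
  let ?B = "B_graph n m k"
  define \<mu> where "\<mu> = l\<^sup>2 - k"
  have \<mu>: "\<mu> > 0" "l\<^sup>2 = \<mu> + k" using l by (auto simp: \<mu>_def)
  define a where "a = (l * Y + k * Z) / \<mu>"
  define c where "c = (l * Z + Y) / \<mu>"
  define x where "x v = (if v = 0 then a else if v < m then Y / l else if v < m + k then c else Z / l)"
    for v :: nat
  have la: "l * a = Y + k * c"
  proof -
    have "\<mu> * (l * a) = l\<^sup>2 * Y + k * (l * Z)"
      using \<mu> by (simp add: a_def field_simps power2_eq_square)
    also have "\<dots> = \<mu> * (Y + k * c)" using \<mu> by (simp add: c_def field_simps)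
    finally show ?thesis using \<mu>(1) by simp
  qed
  have lc: "l * c = Z + a"
  proof -
    have "\<mu> * (l * c) = l\<^sup>2 * Z + l * Y"
      using \<mu> by (simp add: c_def field_simps power2_eq_square)
    also have "\<dots> = \<mu> * (Z + a)" using \<mu> by (simp add: a_def field_simps)
    finally show ?thesis using \<mu>(1) by simp
  qed
  have "(\<Sum>v\<in>{0..<m}. x v) = x 0 + (\<Sum>v\<in>{1..<m}. x v)"
    using mk by (simp add: sum.atLeast_Suc_lessThan)
  also have "(\<Sum>v\<in>{1..<m}. x v) = (\<Sum>v\<in>{1..<m}. Y / l)"
    by (intro sum.cong) (auto simp: x_def)
  also have "x 0 + \<dots> = a + (real m - 1) * (Y / l)" using mk by (simp add: x_def of_nat_diff)
  also have "\<dots> = Y"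
  proof -
    have "\<mu> * ((real m - l) * Y) + k * Y + k * l * Z =
        \<mu> * ((real m - l + k / \<mu>) * Y + (k * l / \<mu>) * Z)"
      using \<mu>(1) by (simp add: field_simps)
    also have "\<dots> = 0" using eq(1) by (simp add: \<mu>_def)
    finally have "\<mu> * ((real m - l) * Y) + k * Y + k * l * Z = 0" .
    moreover have "\<mu> * (l * a) = \<mu> * Y + k * (l * Z + Y)"
      unfolding la using \<mu>(1) by (simp add: c_def field_simps)
    ultimately have "\<mu> * (l * a + (real m - 1) * Y) = \<mu> * (l * Y)"
      by (simp add: algebra_simps)
    then have "l * a + (real m - 1) * Y = l * Y" using \<mu>(1) by simp
    then show ?thesis using l(1) by (simp add: field_simps)
  qed
  finally have sumS: "(\<Sum>v\<in>{0..<m}. x v) = Y" .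
  have "(\<Sum>v\<in>{m..<n}. x v) = (\<Sum>v\<in>{m..<m + k}. x v) + (\<Sum>v\<in>{m + k..<n}. x v)"
    using mk by (simp add: sum.atLeastLessThan_concat)
  also have "(\<Sum>v\<in>{m..<m + k}. x v) = (\<Sum>v\<in>{m..<m + k}. c)"
    using mk by (intro sum.cong) (auto simp: x_def)
  also have "(\<Sum>v\<in>{m + k..<n}. x v) = (\<Sum>v\<in>{m + k..<n}. Z / l)"
    using mk by (intro sum.cong) (auto simp: x_def)
  also have "(\<Sum>v\<in>{m..<m + k}. c) + \<dots> = k * c + (real n - real m - k) * (Z / l)"
    using mk by (simp add: of_nat_diff algebra_simps)
  also have "\<dots> = Z"
  proof -
    have "\<mu> * ((real n - real m - l) * Z) + k * k * Z + k * l * Y =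
        \<mu> * ((k * l / \<mu>) * Y + (real n - real m - l + (real k)\<^sup>2 / \<mu>) * Z)"
      using \<mu>(1) by (simp add: field_simps power2_eq_square)
    also have "\<dots> = 0" using eq(2) by (simp add: \<mu>_def)
    finally have "\<mu> * ((real n - real m - l) * Z) + k * k * Z + k * l * Y = 0" .
    moreover have "\<mu> * (k * (l * c)) = k * (\<mu> * Z + (l * Y + k * Z))"
      unfolding lc using \<mu>(1) by (simp add: a_def field_simps)
    ultimately have "\<mu> * (k * (l * c) + (real n - real m - k) * Z) = \<mu> * (l * Z)"
      by (simp add: algebra_simps)
    then have "k * (l * c) + (real n - real m - k) * Z = l * Z" using \<mu>(1) by simp
    then show ?thesis using l(1) by (simp add: field_simps)
  qed
  finally have sumT: "(\<Sum>v\<in>{m..<n}. x v) = Z" .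
  have "eigenfunction ?B (l - 1) x"
    unfolding eigenfunction_def
  proof (intro conjI ballI)
    show "\<exists>v\<in>verts ?B. x v \<noteq> 0"
    proof (rule ccontr)
      assume "\<not> (\<exists>v\<in>verts ?B. x v \<noteq> 0)"
      then have "x v = 0" if "v < n" for v using that mk by (auto simp: verts_B_graph)
      then have "(\<Sum>v\<in>{0..<m}. x v) = 0" "(\<Sum>v\<in>{m..<n}. x v) = 0"
        using mk by (auto intro!: sum.neutral)
      with sumS sumT nz show False by simp
    qed
  next
    fix v assume "v \<in> verts ?B"
    then have v: "v < n" using mk by (simp add: verts_B_graph)
    have nb: "neighbours ?B v = {w. w < n \<and> v \<noteq> w \<and> (v < m \<and> w < m \<or> m \<le> v \<and> m \<le> w \<or>
      v = 0 \<and> m \<le> w \<and> w < m + k \<or> w = 0 \<and> m \<le> v \<and> v < m + k)}"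
      using B_graph_edge_iff[OF v _ mk] mk by (auto simp: neighbours_def verts_B_graph)
    consider "v = 0" | "0 < v" "v < m" | "m \<le> v" "v < m + k" | "m + k \<le> v" by linarith
    then show "(\<Sum>w\<in>neighbours ?B v. x w) = (l - 1) * x v"
    proof cases
      case 1
      then have "neighbours ?B v = ({0..<m} - {0}) \<union> {m..<m + k}" using mk unfolding nb by auto
      moreover have "({0..<m} - {0}) \<inter> {m..<m + k} = {}" by auto
      ultimately have "(\<Sum>w\<in>neighbours ?B v. x w) =
          (\<Sum>w\<in>{0..<m} - {0}. x w) + (\<Sum>w\<in>{m..<m + k}. x w)"
        by (simp add: sum.union_disjoint)
      also have "(\<Sum>w\<in>{0..<m} - {0}. x w) = Y - x 0"
        using mk sumS by (simp add: sum_diff1)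
      also have "(\<Sum>w\<in>{m..<m + k}. x w) = (\<Sum>w\<in>{m..<m + k}. c)"
        using mk by (intro sum.cong) (auto simp: x_def)
      finally show ?thesis using la 1 by (simp add: x_def algebra_simps)
    next
      case 2
      then have "neighbours ?B v = {0..<m} - {v}" using mk unfolding nb by auto
      then have "(\<Sum>w\<in>neighbours ?B v. x w) = Y - x v" using 2 sumS by (simp add: sum_diff1)
      moreover have "l * x v = Y" using 2 l(1) by (simp add: x_def)
      ultimately show ?thesis by (simp add: algebra_simps)
    next
      case 3
      then have "neighbours ?B v = insert 0 ({m..<n} - {v})" using mk unfolding nb by auto
      then have "(\<Sum>w\<in>neighbours ?B v. x w) = x 0 + (Z - x v)"
        using 3 v sumT mk by (simp add: sum_diff1)
      moreover have "x v = c" "x 0 = a" using 3 mk by (simp_all add: x_def)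
      ultimately show ?thesis using lc by (simp add: algebra_simps)
    next
      case 4
      then have "neighbours ?B v = {m..<n} - {v}" using mk unfolding nb by auto
      then have "(\<Sum>w\<in>neighbours ?B v. x w) = Z - x v" using 4 v sumT by (simp add: sum_diff1)
      moreover have "l * x v = Z" using 4 mk l(1) by (simp add: x_def)
      ultimately show ?thesis by (simp add: algebra_simps)
    qed
  qed
  then show ?thesis using mk by (auto simp: graph_eigenvalue_iff verts_B_graph)
qed

text \<open>A singular symmetric matrix with first row \<open>(\<alpha>, \<beta>)\<close> has \<open>(\<beta>, -\<alpha>)\<close> in its kernel.\<close>

lemma B_graph_eigenvalue_secular:
  assumes "1 \<le> m" "m + k \<le> n" "0 < k" "l > 0" "l\<^sup>2 > real k" "secular n m k l = 0"
  shows "graph_eigenvalue (B_graph n m k) (l - 1)"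
proof (rule B_graph_eigenvalue[OF assms(1,2,4,5)])
  let ?\<alpha> = "real m - l + k / (l\<^sup>2 - k)" and ?\<beta> = "k * l / (l\<^sup>2 - k)"
  show "?\<beta> \<noteq> 0 \<or> - ?\<alpha> \<noteq> 0" using assms by simp
  have "a * b + b * - a = 0" for a b :: real by simp
  then show "?\<alpha> * ?\<beta> + ?\<beta> * - ?\<alpha> = 0" .
  have "b * b + c * - a = 0" if "a * c - b\<^sup>2 = 0" for a b c :: real
    using that by (simp add: power2_eq_square algebra_simps)
  from this[OF assms(6)[unfolded secular_def]]
  show "?\<beta> * ?\<beta> + (real n - real m - l + (real k)\<^sup>2 / (l\<^sup>2 - k)) * - ?\<alpha> = 0" .
qed

lemma secular_pos:
  assumes "1 \<le> m" "m + k \<le> n" "l \<ge> real n + 3"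
  shows "secular n m k l > 0"
proof -
  have kl: "real k + 3 \<le> l" using assms by linarith
  have l0: "l > 0" using assms by simp
  have "real k * l + l \<le> l\<^sup>2"
    using mult_right_mono[of "real k + 1" l l] kl l0 by (simp add: power2_eq_square algebra_simps)
  moreover have "real k * l \<ge> 0" using l0 by simp
  ultimately have \<mu>: "l\<^sup>2 - k \<ge> k * l" "l\<^sup>2 - k > 0" using kl by linarith+
  have kk: "real k * k \<le> k * l" using kl by (intro mult_left_mono) auto
  have k1: "real k \<le> k * l" using kl by (simp add: mult_le_cancel_left1)
  have b: "k * l / (l\<^sup>2 - k) \<le> 1" "0 \<le> k * l / (l\<^sup>2 - k)" using \<mu> l0 by (auto simp: divide_le_eq)
  have c: "(real k)\<^sup>2 / (l\<^sup>2 - k) \<le> 1" "real k / (l\<^sup>2 - k) \<le> 1"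
    using \<mu> kk k1 by (auto simp: divide_le_eq power2_eq_square)
  have "2 * 2 \<le> (- (real m - l + k / (l\<^sup>2 - k))) * (- (real n - real m - l + (real k)\<^sup>2 / (l\<^sup>2 - k)))"
    using c assms by (intro mult_mono) auto
  moreover have "(k * l / (l\<^sup>2 - k))\<^sup>2 \<le> 1" using b by (rule power_le_one[rotated])
  ultimately show ?thesis unfolding secular_def minus_mult_minus by linarith
qed

lemma B_graph_spectral_radius_secular:
  assumes "1 \<le> m" "m + k \<le> n" "0 < k" "l > 0" "l\<^sup>2 > real k"
  shows "secular n m k l \<le> 0 \<Longrightarrow> l - 1 \<le> graph_spectral_radius (B_graph n m k)"
    and "secular n m k l < 0 \<Longrightarrow> l - 1 < graph_spectral_radius (B_graph n m k)"
proof -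
  have root: "\<exists>t\<ge>l. secular n m k t = 0" if "secular n m k l \<le> 0"
  proof -
    have "l < real n + 3" using secular_pos[OF assms(1,2), of l] that by fastforce
    moreover have "continuous_on {l..real n + 3} (secular n m k)"
    proof -
      have "t\<^sup>2 - k \<noteq> 0" if "t \<in> {l..real n + 3}" for t
      proof -
        have "l\<^sup>2 \<le> t\<^sup>2" using that assms(4) by (intro power_mono) auto
        then show ?thesis using assms(5) by linarith
      qed
      then show ?thesis unfolding secular_def by (intro continuous_intros) auto
    qed
    ultimately show ?thesis
      using IVT'[of "secular n m k" l 0 "real n + 3"] that
        secular_pos[OF assms(1,2), of "real n + 3"] by fastforce
  qed
  have ge: "t - 1 \<le> graph_spectral_radius (B_graph n m k)" if "t \<ge> l" "secular n m k t = 0" for t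
  proof (rule graph_spectral_radius_ge)
    show "finite (verts (B_graph n m k))" using assms by (simp add: verts_B_graph)
    have "l\<^sup>2 \<le> t\<^sup>2" using that assms(4) by (intro power_mono) auto
    then have "t\<^sup>2 > k" using assms(5) by linarith
    then show "graph_eigenvalue (B_graph n m k) (t - 1)"
      using that assms by (intro B_graph_eigenvalue_secular) auto
  qed
  show "secular n m k l \<le> 0 \<Longrightarrow> l - 1 \<le> graph_spectral_radius (B_graph n m k)"
    using root ge by fastforce
  assume neg: "secular n m k l < 0"
  then obtain t where t: "t \<ge> l" "secular n m k t = 0" using root by auto
  with neg have "t \<noteq> l" by auto
  with t ge[OF t] show "l - 1 < graph_spectral_radius (B_graph n m k)" by simp
qed

text \<open>The number \<open>q\<close> is the value at \<open>(Y, Z)\<close> of the quadratic form with determinant \<open>secular n m k l\<close>. Its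
  coefficient of \<open>Y\<^sup>2\<close> is negative, so a nonnegative value forces a nonpositive determinant. At a point
  with \<open>Y = Z\<close> the determinant is even negative, because the two diagonal coefficients differ.\<close>

lemma secular_form:
  fixes l Y Z q :: real
  assumes mn: "k + 2 \<le> n - m" "m + 2 \<le> n - m" and "0 < k" and l: "l \<ge> real n - real m"
    and YZ: "0 \<le> Y" "0 \<le> Z" "Y \<noteq> 0 \<or> Z \<noteq> 0"
  defines "q \<equiv> m * Y\<^sup>2 + (real n - real m) * Z\<^sup>2 +
    (2 * l * k * Y * Z + (real k)\<^sup>2 * Z\<^sup>2 + k * Y\<^sup>2) / (l\<^sup>2 - k) - l * (Y\<^sup>2 + Z\<^sup>2)"
  shows "0 \<le> q \<Longrightarrow> secular n m k l \<le> 0"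
    and "0 < q \<or> 0 \<le> q \<and> Y = Z \<Longrightarrow> secular n m k l < 0"
proof -
  define \<alpha> where "\<alpha> = real m - l + k / (l\<^sup>2 - k)"
  define \<beta> where "\<beta> = k * l / (l\<^sup>2 - k)"
  define \<gamma> where "\<gamma> = real n - real m - l + (real k)\<^sup>2 / (l\<^sup>2 - k)"
  have h: "secular n m k l = \<alpha> * \<gamma> - \<beta>\<^sup>2"
    by (simp add: secular_def \<alpha>_def \<beta>_def \<gamma>_def)
  have lk: "real k + 2 \<le> l" "real m + 2 \<le> real n - real m" using mn l by linarith+
  have "(real k + 2)\<^sup>2 \<le> l\<^sup>2" using lk by (intro power_mono) auto
  then have \<mu>: "l\<^sup>2 - k > k" by (simp add: power2_eq_square algebra_simps)
       (use \<open>0 < k\<close> zero_le_square[of "real k"] in linarith)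
  then have "k / (l\<^sup>2 - k) < 1" by (simp add: divide_less_eq)
  then have \<alpha>: "\<alpha> < 0" using lk l by (simp add: \<alpha>_def)
  have \<beta>: "\<beta> > 0" using \<mu> lk \<open>0 < k\<close> by (simp add: \<beta>_def)
  have "real k \<le> (real k)\<^sup>2" using \<open>0 < k\<close> by (simp add: power2_eq_square)
  then have "k / (l\<^sup>2 - k) \<le> (real k)\<^sup>2 / (l\<^sup>2 - k)" using \<mu> by (intro divide_right_mono) auto
  then have \<alpha>\<gamma>: "\<alpha> < \<gamma>" using lk by (simp add: \<alpha>_def \<gamma>_def)
  have q: "q = \<alpha> * Y\<^sup>2 + 2 * \<beta> * Y * Z + \<gamma> * Z\<^sup>2"
    by (simp add: q_def \<alpha>_def \<beta>_def \<gamma>_def add_divide_distrib algebra_simps)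
  have sq: "\<alpha> * q = (\<alpha> * Y + \<beta> * Z)\<^sup>2 + secular n m k l * Z\<^sup>2"
    by (simp add: q h power2_eq_square algebra_simps)
  have Z: "Z\<^sup>2 > 0" if "0 \<le> q"
  proof (rule ccontr)
    assume "\<not> Z\<^sup>2 > 0"
    then have "Z = 0" by simp
    then have "q = \<alpha> * Y\<^sup>2" "Y \<noteq> 0" using YZ q by auto
    then have "q < 0" using \<alpha> by (simp add: mult_neg_pos)
    with that show False by simp
  qed
  show "secular n m k l \<le> 0" if "0 \<le> q"
  proof -
    have "\<alpha> * q \<le> 0" using \<alpha> that by (simp add: mult_nonpos_nonneg)
    then have "secular n m k l * Z\<^sup>2 \<le> 0" using sq zero_le_power2[of "\<alpha> * Y + \<beta> * Z"] by linarith
    then show ?thesis using Z[OF that] by (simp add: mult_le_0_iff)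
  qed
  assume "0 < q \<or> 0 \<le> q \<and> Y = Z"
  then show "secular n m k l < 0"
  proof
    assume "0 < q"
    then have "\<alpha> * q < 0" using \<alpha> by (simp add: mult_neg_pos)
    then have "secular n m k l * Z\<^sup>2 < 0" using sq zero_le_power2[of "\<alpha> * Y + \<beta> * Z"] by linarith
    then show ?thesis using Z \<open>0 < q\<close> by (simp add: mult_less_0_iff)
  next
    assume "0 \<le> q \<and> Y = Z"
    then have "0 \<le> (\<alpha> + 2 * \<beta> + \<gamma>) * Z\<^sup>2" "Z\<^sup>2 > 0"
      using Z by (auto simp: q power2_eq_square algebra_simps)
    then have s: "0 \<le> \<alpha> + 2 * \<beta> + \<gamma>" by (simp add: zero_le_mult_iff)
    have "\<alpha> * \<gamma> < \<beta>\<^sup>2"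
    proof (cases "\<gamma> < 0")
      case True
      have "(- \<alpha> - \<gamma>)\<^sup>2 \<le> (2 * \<beta>)\<^sup>2" using s \<alpha> True by (intro power_mono) auto
      moreover have "(\<alpha> - \<gamma>)\<^sup>2 > 0" using \<alpha>\<gamma> by simp
      ultimately show ?thesis by (simp add: power2_eq_square algebra_simps)
    next
      case False
      then have "\<alpha> * \<gamma> \<le> 0" using \<alpha> by (simp add: mult_nonpos_nonneg)
      also have "0 < \<beta>\<^sup>2" using \<beta> by simp
      finally show ?thesis .
    qed
    then show ?thesis by (simp add: h)
  qed
qed

section \<open>Minimum edge cuts\<close>

lemma simple_graph_finite_edges:
  assumes "simple_graph G"
  shows "finite (edges G)"
  using assms finite_subset[of "edges G" "Pow (verts G)"] unfolding simple_graph_def by blast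

text \<open>A minimum edge cut consists exactly of the edges that leave a component of the remaining graph.\<close>

lemma edge_connectivity_cut:
  assumes G: "simple_graph G" and n: "2 \<le> card (verts G)"
  obtains S T where "verts G = S \<union> T" "S \<inter> T = {}" "S \<noteq> {}" "T \<noteq> {}"
    "card (cross G S T) = edge_connectivity G"
proof -
  let ?C = "{F. edge_cut G F}"
  have finE: "finite (edges G)" using G by (rule simple_graph_finite_edges)
  have finC: "finite ?C"
    using finE by (intro finite_subset[of ?C "Pow (edges G)"]) (auto simp: edge_cut_def)
  obtain a b where ab: "a \<in> verts G" "b \<in> verts G" "a \<noteq> b"
  proof -
    have "finite (verts G)" "\<not> card (verts G) \<le> Suc 0"
      using n G by (auto simp: simple_graph_def)
    then show ?thesis using that card_le_Suc0_iff_eq by blast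
  qed
  have "edges G \<in> ?C"
    using ab by (auto simp: edge_cut_def graph_connected_def)
  then have "edge_connectivity G \<in> card ` ?C"
    unfolding edge_connectivity_def using finC by (intro Min_in) auto
  then obtain F where F: "edge_cut G F" "card F = edge_connectivity G" by auto
  let ?R = "{(x, y). {x, y} \<in> edges G - F}"
  obtain u v where uv: "u \<in> verts G" "v \<in> verts G" "(u, v) \<notin> ?R\<^sup>*"
    using F(1) ab(1) unfolding edge_cut_def graph_connected_def by auto
  \<comment> \<open>\<open>S\<close> is the component of \<open>u\<close> after removal of the cut.\<close>
  define S where "S = {w \<in> verts G. (u, w) \<in> ?R\<^sup>*}"
  define T where "T = verts G - S"
  have V: "verts G = S \<union> T" "S \<inter> T = {}" "u \<in> S" "v \<in> T"
    using uv by (auto simp: S_def T_def)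
  let ?E = "(\<lambda>(i, j). {i, j}) ` cross G S T"
  have inj: "inj_on (\<lambda>(i, j). {i, j}) (cross G S T)"
    using V(2) by (auto simp: inj_on_def cross_def doubleton_eq_iff)
  have "{i, j} \<in> F" if "(i, j) \<in> cross G S T" for i j
  proof (rule ccontr)
    assume "{i, j} \<notin> F"
    then have "(u, j) \<in> ?R\<^sup>*"
      using that unfolding cross_def S_def by (auto intro: rtrancl_into_rtrancl)
    then show False using that V(1) unfolding cross_def S_def T_def by auto
  qed
  then have "?E \<subseteq> F" by auto
  moreover have "finite F" using F(1) finE unfolding edge_cut_def by (auto intro: finite_subset)
  ultimately have le: "card (cross G S T) \<le> edge_connectivity G"
    using card_mono[of F ?E] card_image[OF inj] F(2) by simp
  have "(u, w) \<in> {(x, y). {x, y} \<in> edges G - ?E}\<^sup>* \<Longrightarrow> w \<in> S" for w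
  proof (induction rule: rtrancl_induct)
    case base
    show ?case by (rule V(3))
  next
    case (step y z)
    then have yz: "{y, z} \<in> edges G" "{y, z} \<notin> ?E" "y \<in> S" by auto
    then have "z \<in> verts G" using G unfolding simple_graph_def by auto
    moreover have "(y, z) \<notin> cross G S T" using yz(2) by force
    ultimately show ?case using yz V(1) unfolding cross_def by auto
  qed
  then have "(u, v) \<notin> {(x, y). {x, y} \<in> edges G - ?E}\<^sup>*" using V by blast
  then have "\<not> graph_connected (verts G, edges G - ?E)"
    using uv(1,2) unfolding graph_connected_def fst_conv snd_conv by blast
  moreover have "?E \<subseteq> edges G" by (auto simp: cross_def)
  ultimately have "?E \<in> ?C" by (simp add: edge_cut_def)
  then have "card ?E \<in> card ` ?C" by (rule imageI)
  then have "edge_connectivity G \<le> card ?E"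
    unfolding edge_connectivity_def using finC by (intro Min_le) auto
  also have "\<dots> = card (cross G S T)" by (rule card_image[OF inj])
  finally have "edge_connectivity G \<le> card (cross G S T)" .
  with le have "card (cross G S T) = edge_connectivity G" by simp
  moreover have "S \<noteq> {}" "T \<noteq> {}" using V by auto
  ultimately show ?thesis using that[OF V(1,2)] by simp
qed

lemma vertex_degree_eq_card_neighbours:
  assumes "simple_graph G"
  shows "vertex_degree G v = card (neighbours G v)"
proof -
  have "\<exists>w. e = {v, w} \<and> w \<in> verts G" if "e \<in> edges G" "v \<in> e" for e
  proof -
    have "card e = 2" "e \<subseteq> verts G" using that assms unfolding simple_graph_def by auto
    then show ?thesis using that(2) unfolding card_2_iff by auto
  qed
  then have "{e \<in> edges G. v \<in> e} = (\<lambda>w. {v, w}) ` neighbours G v"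
    unfolding neighbours_def by blast
  moreover have "inj_on (\<lambda>w. {v, w}) (neighbours G v)"
    by (auto simp: inj_on_def doubleton_eq_iff)
  ultimately show ?thesis unfolding vertex_degree_def by (simp add: card_image)
qed

text \<open>On a side with \<open>s \<le> \<delta>\<close> vertices, each vertex has at least \<open>\<delta> - (s - 1)\<close> neighbours across the cut,
  and \<open>s * (\<delta> - (s - 1)) \<ge> \<delta>\<close>.\<close>

lemma small_cut_side_large:
  assumes G: "simple_graph G" "verts G = S \<union> T" "S \<inter> T = {}" "S \<noteq> {}"
    and cut: "card (cross G S T) < min_degree G"
  shows "min_degree G < card S"
proof (rule ccontr)
  let ?d = "min_degree G" and ?P = "cross G S T"
  assume "\<not> ?d < card S"
  then have sd: "card S \<le> ?d" by simp
  have fin: "finite S" "finite T" using G(1,2) unfolding simple_graph_def by auto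
  have s1: "1 \<le> card S" using fin G(4) by (simp add: Suc_leI card_gt_0_iff)
  have deg: "?d \<le> (card S - 1) + card (?P `` {v})" if v: "v \<in> S" for v
  proof -
    have "?d \<le> vertex_degree G v"
      unfolding min_degree_def using fin G(2) v by (intro Min_le) auto
    also have "\<dots> = card (neighbours G v)" using G(1) by (rule vertex_degree_eq_card_neighbours)
    also have "\<dots> \<le> card ((S - {v}) \<union> ?P `` {v})"
    proof (rule card_mono)
      show "finite ((S - {v}) \<union> ?P `` {v})"
        using fin by (auto simp: cross_def intro: finite_subset[of _ T])
      have "{v} \<notin> edges G" using G(1) unfolding simple_graph_def by fastforce
      then show "neighbours G v \<subseteq> (S - {v}) \<union> ?P `` {v}"
        using G(2) v by (auto simp: neighbours_def cross_def)
    qed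
    also have "\<dots> \<le> card (S - {v}) + card (?P `` {v})" by (rule card_Un_le)
    finally show ?thesis using fin v by simp
  qed
  have "card S * ?d = (\<Sum>v\<in>S. ?d)" by simp
  also have "\<dots> \<le> (\<Sum>v\<in>S. (card S - 1) + card (?P `` {v}))" by (intro sum_mono deg)
  also have "\<dots> = card S * (card S - 1) + card ?P"
    using card_eq_sum_left[OF fin cross_subset, of G] by (simp add: sum.distrib)
  finally have "card S * ?d < card S * (card S - 1) + ?d" using cut by simp
  then have "int (card S) * int ?d < int (card S) * (int (card S) - 1) + int ?d"
    using s1 by (metis (no_types, lifting) of_nat_1 of_nat_add of_nat_diff of_nat_less_iff of_nat_mult)
  then have "(int (card S) - 1) * (int ?d - int (card S)) < 0"
    by (simp add: algebra_simps)
  moreover have "0 \<le> (int (card S) - 1) * (int ?d - int (card S))"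
    using s1 sd by (intro mult_nonneg_nonneg) auto
  ultimately show False by simp
qed

section \<open>Cliques joined by a star\<close>

text \<open>Two cliques that are joined by a star centred in \<open>S\<close> form the graph \<open>B\<close>. The isomorphism maps the
  centre, the rest of \<open>S\<close>, the leaves, and the rest of \<open>T\<close> to consecutive intervals.\<close>

lemma star_cut_iso_B_graph:
  assumes G: "simple_graph G" "verts G = S \<union> T" "S \<inter> T = {}"
    and n: "card (verts G) = n" and k: "card (cross G S T) = k" "0 < k"
    and clique: "\<And>u v. u \<noteq> v \<Longrightarrow> u \<in> S \<and> v \<in> S \<or> u \<in> T \<and> v \<in> T \<Longrightarrow> {u, v} \<in> edges G"
    and star: "\<And>i j i' j'. (i, j) \<in> cross G S T \<Longrightarrow> (i', j') \<in> cross G S T \<Longrightarrow> i = i'"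
  shows "graph_iso G (B_graph n (card S) k)"
proof -
  let ?P = "cross G S T" and ?m = "card S"
  have fin: "finite S" "finite T" using G(1,2) unfolding simple_graph_def by auto
  have "?P \<noteq> {}" using k by auto
  then obtain c j0 where c: "(c, j0) \<in> ?P" by auto
  define J where "J = ?P `` {c}"
  have P: "?P = Pair c ` J"
  proof -
    have "p \<in> Pair c ` J" if "p \<in> ?P" for p
      using star[OF c, of "fst p" "snd p"] that by (cases p) (auto simp: J_def)
    then show ?thesis unfolding J_def by blast
  qed
  have cS: "c \<in> S" and JT: "J \<subseteq> T" using c unfolding J_def cross_def by auto
  have Jk: "card J = k" using k(1) unfolding P by (simp add: card_image inj_on_def)
  have finJ: "finite J" using JT fin finite_subset by blast
  have nST: "n = ?m + card T" using n fin G(2,3) by (simp add: card_Un_disjoint)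
  have kT: "k \<le> card T" using JT fin card_mono Jk by blast
  have m1: "1 \<le> ?m" using cS fin by (metis One_nat_def Suc_leI card_gt_0_iff empty_iff)
  obtain f1 where f1: "bij_betw f1 (S - {c}) {1..<?m}"
    using finite_same_card_bij[of "S - {c}" "{1..<?m}"] fin cS by auto
  obtain f2 where f2: "bij_betw f2 J {?m..<?m + k}"
    using finite_same_card_bij[of J "{?m..<?m + k}"] finJ Jk by auto
  have "card (T - J) = n - (?m + k)" using nST Jk JT finJ by (simp add: card_Diff_subset)
  then obtain f3 where f3: "bij_betw f3 (T - J) {?m + k..<n}"
    using finite_same_card_bij[of "T - J" "{?m + k..<n}"] fin by auto
  define f where "f v = (if v = c then 0 else if v \<in> S then f1 v else if v \<in> J then f2 v else f3 v)" for v
  have b0: "bij_betw f {c} {0}" by (simp add: f_def bij_betw_def)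
  have b1: "bij_betw f (S - {c}) {1..<?m}"
    using f1 by (subst bij_betw_cong[where g = f1]) (auto simp: f_def)
  have b2: "bij_betw f J {?m..<?m + k}"
    using f2 cS JT G(3) by (subst bij_betw_cong[where g = f2]) (auto simp: f_def)
  have b3: "bij_betw f (T - J) {?m + k..<n}"
    using f3 cS JT G(3) by (subst bij_betw_cong[where g = f3]) (auto simp: f_def)
  have bS: "bij_betw f S {0..<?m}"
  proof -
    have "{c} \<union> (S - {c}) = S" "{0} \<union> {1..<?m} = {0..<?m}" using cS m1 by auto
    then show ?thesis using bij_betw_combine[OF b0 b1] by auto
  qed
  have bT: "bij_betw f T {?m..<n}"
  proof -
    have "J \<union> (T - J) = T" "{?m..<?m + k} \<union> {?m + k..<n} = {?m..<n}" using JT nST kT by auto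
    then show ?thesis using bij_betw_combine[OF b2 b3] by auto
  qed
  have b: "bij_betw f (verts G) {0..<n}"
  proof -
    have "{0..<?m} \<union> {?m..<n} = {0..<n}" using nST by auto
    then show ?thesis using bij_betw_combine[OF bS bT] G(2) by auto
  qed
  have inS: "f v < ?m \<longleftrightarrow> v \<in> S" and inT: "?m \<le> f v \<longleftrightarrow> v \<in> T" and lt: "f v < n"
    and inJ: "v \<in> T \<and> f v < ?m + k \<longleftrightarrow> v \<in> J" and is0: "f v = 0 \<longleftrightarrow> v = c"
    if v: "v \<in> verts G" for v
  proof -
    have fS: "f v < ?m" if "v \<in> S" using bij_betwE[OF bS] that by auto
    have fT: "?m \<le> f v" if "v \<in> T" using bij_betwE[OF bT] that by auto
    have fJ: "f v < ?m + k" if "v \<in> J" using bij_betwE[OF b2] that by auto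
    have fTJ: "?m + k \<le> f v" if "v \<in> T" "v \<notin> J" using bij_betwE[OF b3] that by auto
    have fSc: "1 \<le> f v" if "v \<in> S" "v \<noteq> c" using bij_betwE[OF b1] that by auto
    have vST: "v \<in> S \<and> v \<notin> T \<or> v \<in> T \<and> v \<notin> S" using v G(2,3) by blast
    show "f v < ?m \<longleftrightarrow> v \<in> S" "?m \<le> f v \<longleftrightarrow> v \<in> T" using fS fT vST by linarith+
    show "f v < n" using bij_betwE[OF b] v by auto
    show "v \<in> T \<and> f v < ?m + k \<longleftrightarrow> v \<in> J" using fS fT fJ fTJ vST JT by (meson not_le subsetD)
    have "f c = 0" by (simp add: f_def)
    moreover have "1 \<le> f v" if "v \<noteq> c" using fSc fT vST m1 that by linarith
    ultimately show "f v = 0 \<longleftrightarrow> v = c" by (metis not_one_le_zero)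
  qed
  have edge: "{u, v} \<in> edges G \<longleftrightarrow> u \<noteq> v \<and> (u \<in> S \<and> v \<in> S \<or> u \<in> T \<and> v \<in> T \<or>
      u = c \<and> v \<in> J \<or> v = c \<and> u \<in> J)" if uv: "u \<in> verts G" "v \<in> verts G" for u v
  proof -
    have "{u} \<notin> edges G" using G(1) unfolding simple_graph_def by fastforce
    then have ne: "{u, v} \<in> edges G \<Longrightarrow> u \<noteq> v" by auto
    have p: "(u, v) \<in> ?P \<longleftrightarrow> u = c \<and> v \<in> J" "(v, u) \<in> ?P \<longleftrightarrow> v = c \<and> u \<in> J" unfolding P by auto
    have e: "{u, v} \<in> edges G \<Longrightarrow> u \<in> S \<Longrightarrow> v \<in> T \<Longrightarrow> (u, v) \<in> ?P"
      "{u, v} \<in> edges G \<Longrightarrow> v \<in> S \<Longrightarrow> u \<in> T \<Longrightarrow> (v, u) \<in> ?P"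
      "(u, v) \<in> ?P \<Longrightarrow> {u, v} \<in> edges G" "(v, u) \<in> ?P \<Longrightarrow> {u, v} \<in> edges G"
      by (auto simp: cross_def insert_commute)
    consider "u \<in> S" "v \<in> S" "u \<notin> T" "v \<notin> T" | "u \<in> T" "v \<in> T" "u \<notin> S" "v \<notin> S"
      | "u \<in> S" "v \<in> T" "u \<notin> T" "v \<notin> S" | "u \<in> T" "v \<in> S" "u \<notin> S" "v \<notin> T"
      using uv G(2,3) by blast
    then show ?thesis using p e ne clique[of u v] cS JT by cases blast+
  qed
  show ?thesis
    unfolding graph_iso_def
  proof (intro exI[of _ f] conjI ballI)
    show "bij_betw f (verts G) (verts (B_graph n ?m k))"
      using b nST by (simp add: verts_B_graph)
    fix u v assume uv: "u \<in> verts G" "v \<in> verts G"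
    have "f u = f v \<longleftrightarrow> u = v"
      using b uv by (auto simp: bij_betw_def inj_on_def)
    moreover have mk: "?m + k \<le> n" using nST kT by simp
    ultimately show "{u, v} \<in> edges G \<longleftrightarrow> {f u, f v} \<in> edges (B_graph n ?m k)"
      unfolding edge[OF uv] B_graph_edge_iff[OF lt[OF uv(1)] lt[OF uv(2)] m1 mk]
      by (simp only: inJ[OF uv(1)] inJ[OF uv(2)] inS[OF uv(1)] inS[OF uv(2)] inT[OF uv(1)] inT[OF uv(2)]
          is0[OF uv(1)] is0[OF uv(2)])
  qed
qed

section \<open>Comparison of the spectral radii\<close>

text \<open>The comparison for a cut whose sides are named so that \<open>S\<close> carries the smaller sum of \<open>x\<close>. This
  side, not the one with fewer vertices, is compared with the clique of order \<open>m\<close> in \<open>B\<close>.\<close>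

lemma spectral_radius_compare_ordered:
  fixes x :: "'a \<Rightarrow> real" and l :: real
  assumes G: "simple_graph G" "verts G = S \<union> T" "S \<inter> T = {}" "card (verts G) = n"
    and k: "card (cross G S T) = k" "0 < k" and m: "1 \<le> m" "m \<le> card S"
    and mn: "k + 2 \<le> n - m" "m + 2 \<le> n - m"
    and x: "\<And>v. x v \<ge> 0" "\<exists>v\<in>verts G. x v \<noteq> 0"
    and sub: "\<And>v. v \<in> verts G \<Longrightarrow> (l - 1) * x v \<le> (\<Sum>w\<in>neighbours G v. x w)"
    and l: "real n - real m \<le> l" and le: "sum x S \<le> sum x T"
  shows "l - 1 < graph_spectral_radius (B_graph n m k) \<or>
    l - 1 \<le> graph_spectral_radius (B_graph n m k) \<and> graph_iso G (B_graph n m k)"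
proof -
  let ?P = "cross G S T"
  define Y where "Y = sum x S"
  define Z where "Z = sum x T"
  have fin: "finite S" "finite T" using G(1,2) unfolding simple_graph_def by auto
  have finP: "finite ?P" using fin cross_subset[of G S T] by (auto intro: finite_subset)
  have nST: "card S + card T = n" using G(2,3,4) fin by (simp add: card_Un_disjoint)
  have lk: "real k + 2 \<le> l" "real m + 2 \<le> real n - real m" "m + k \<le> n" using mn l by linarith+
  have l0: "l > 0" using lk by simp
  have "(real k + 2)\<^sup>2 \<le> l\<^sup>2" using lk by (intro power_mono) auto
  moreover have "(real k + 2)\<^sup>2 > k" by (simp add: power2_eq_square algebra_simps add_pos_nonneg)
  ultimately have lsq: "l\<^sup>2 > k" by linarith
  define \<mu> where "\<mu> = l\<^sup>2 - k"
  have \<mu>: "\<mu> > 0" using lsq by (simp add: \<mu>_def)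
  have YZ: "0 \<le> Y" "0 \<le> Z" "Y \<le> Z" using le unfolding Y_def Z_def by (auto intro: sum_nonneg x)
  have Zpos: "Z > 0"
  proof (rule ccontr)
    assume "\<not> Z > 0"
    then have "Y = 0" "Z = 0" using YZ by auto
    then have "x v = 0" if "v \<in> S \<union> T" for v
      using that fin x(1) sum_nonneg_eq_0_iff[of S x] sum_nonneg_eq_0_iff[of T x]
      unfolding Y_def Z_def by auto
    then show False using x(2) G(2) by auto
  qed
  have YZsq: "Y\<^sup>2 \<le> Z\<^sup>2" using YZ by (intro power_mono) auto
  define D where "D = sharing ?P"
  define E where "E = sharing (?P\<inverse>)"
  have D: "real D \<le> (real k)\<^sup>2" using sharing_le[OF finP] unfolding D_def k(1) by (simp flip: of_nat_power)
  have DE: "real D + real E \<le> (real k)\<^sup>2 + k"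
    using sharing_add_converse_le[OF finP] unfolding D_def E_def k(1)
    by (simp flip: of_nat_power of_nat_add)
  define R where "R = card S * Y\<^sup>2 + card T * Z\<^sup>2 + (2 * l * k * Y * Z + D * Z\<^sup>2 + E * Y\<^sup>2) / \<mu>"
  define q where "q = m * Y\<^sup>2 + (real n - real m) * Z\<^sup>2 +
    (2 * l * k * Y * Z + (real k)\<^sup>2 * Z\<^sup>2 + k * Y\<^sup>2) / (l\<^sup>2 - k) - l * (Y\<^sup>2 + Z\<^sup>2)"
  have lsq': "real (card ?P) < l\<^sup>2" using lsq k(1) by simp
  have bound: "l * (Y\<^sup>2 + Z\<^sup>2) \<le> R"
    using two_block_bound(1)[OF G(1-3) x(1) sub l0 lsq']
    unfolding R_def Y_def Z_def D_def E_def \<mu>_def k(1) by simp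
  have tT: "real (card T) = real n - real (card S)" using nST by linarith
  have "q = (R - l * (Y\<^sup>2 + Z\<^sup>2)) + (real (card S) - real m) * (Z\<^sup>2 - Y\<^sup>2) +
      (((real k)\<^sup>2 - D) * Z\<^sup>2 + (real k - E) * Y\<^sup>2) / \<mu>"
    unfolding q_def R_def tT \<mu>_def[symmetric]
    by (simp add: algebra_simps add_divide_distrib diff_divide_distrib)
  moreover have "((real k)\<^sup>2 - D) * (Z\<^sup>2 - Y\<^sup>2) \<le> ((real k)\<^sup>2 - D) * Z\<^sup>2 + (real k - E) * Y\<^sup>2"
    using mult_right_mono[OF DE, of "Y\<^sup>2"] by (simp add: algebra_simps)
  then have "((real k)\<^sup>2 - D) * (Z\<^sup>2 - Y\<^sup>2) / \<mu> \<le> (((real k)\<^sup>2 - D) * Z\<^sup>2 + (real k - E) * Y\<^sup>2) / \<mu>"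
    using \<mu> by (intro divide_right_mono) auto
  ultimately have qge: "q \<ge> (R - l * (Y\<^sup>2 + Z\<^sup>2)) + (real (card S) - real m) * (Z\<^sup>2 - Y\<^sup>2) +
      ((real k)\<^sup>2 - D) * (Z\<^sup>2 - Y\<^sup>2) / \<mu>" by linarith
  have g1: "(real (card S) - real m) * (Z\<^sup>2 - Y\<^sup>2) \<ge> 0" using m YZsq by simp
  have g2: "((real k)\<^sup>2 - D) * (Z\<^sup>2 - Y\<^sup>2) / \<mu> \<ge> 0" using D \<mu> YZsq by simp
  have q0: "q \<ge> 0" using qge g1 g2 bound by linarith
  have nz: "Y \<noteq> 0 \<or> Z \<noteq> 0" using Zpos by simp
  note form = secular_form[OF mn k(2) l YZ(1,2) nz, folded q_def]
  note radius = B_graph_spectral_radius_secular[OF m(1) lk(3) k(2) l0 lsq]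
  show ?thesis
  proof (cases "q > 0 \<or> Y = Z")
    case True
    then show ?thesis using form(2) q0 radius(2) by blast
  next
    case False
    then have q: "q = 0" and YltZ: "Y < Z" using q0 YZ by auto
    have sqlt: "Y\<^sup>2 < Z\<^sup>2" using YltZ YZ by (intro power_strict_mono) auto
    \<comment> \<open>By \<open>qge\<close>, \<open>q\<close> is at least a sum of three nonnegative gaps, so all of them vanish.\<close>
    have "R = l * (Y\<^sup>2 + Z\<^sup>2)" "(real (card S) - real m) * (Z\<^sup>2 - Y\<^sup>2) = 0"
      "((real k)\<^sup>2 - D) * (Z\<^sup>2 - Y\<^sup>2) / \<mu> = 0"
      using qge g1 g2 bound q by linarith+
    then have eqs: "l * (Y\<^sup>2 + Z\<^sup>2) = R" "card S = m" "D = k\<^sup>2"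
      using sqlt \<mu> by (auto simp flip: of_nat_power)
    \<comment> \<open>If \<open>x\<close> vanished on \<open>S\<close>, then \<open>T\<close> alone would give \<open>l \<le> n - m\<close>, and the form would be positive
      because of its term \<open>k\<^sup>2 * Z\<^sup>2 / \<mu>\<close>.\<close>
    have "Y > 0"
    proof (rule ccontr)
      assume "\<not> Y > 0"
      then have "Y = 0" using YZ by simp
      then have "x v = 0" if "v \<in> S" for v
        using that fin x(1) sum_nonneg_eq_0_iff[of S x] unfolding Y_def by auto
      then have "(\<Sum>(i, j)\<in>cross G T S. x j) = 0"
        by (intro sum.neutral) (auto simp: cross_def)
      moreover have "verts G = T \<union> S" "T \<inter> S = {}" using G(2,3) by auto
      moreover have "(l - 1) * x v \<le> (\<Sum>w\<in>neighbours G v. x w)" if "v \<in> T" for v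
        using sub that G(2) by blast
      ultimately have "l * Z \<le> card T * Z"
        using block_bound(1)[where x = x and S = T and T = S and l = l, OF G(1) _ _ x(1)]
        unfolding Z_def by fastforce
      then have "l \<le> card T" using Zpos by simp
      then have "l = real n - real m" using l eqs(2) nST by linarith
      then have "q = (real k)\<^sup>2 * Z\<^sup>2 / \<mu>" unfolding q_def \<mu>_def \<open>Y = 0\<close> by simp
      then show False using q k(2) Zpos \<mu> by simp
    qed
    then have clique: "{u, v} \<in> edges G"
      if "u \<noteq> v" "u \<in> S \<and> v \<in> S \<or> u \<in> T \<and> v \<in> T" for u v
      using two_block_bound(2)[OF G(1-3) x(1) sub l0 lsq' _ _ _ that] eqs(1) Zpos
      unfolding R_def Y_def Z_def D_def E_def \<mu>_def k(1) by simp
    have "graph_iso G (B_graph n (card S) k)"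
      using sharing_eq_imp_star[OF finP] eqs(3) k(1)
      by (intro star_cut_iso_B_graph[OF G k clique]) (auto simp: D_def)
    then show ?thesis using radius(1) form(1) q0 eqs(2) by simp
  qed
qed

lemma spectral_radius_compare:
  fixes G :: "'a sgraph"
  assumes k: "0 < k" "k < d" and n: "2 * d + 4 \<le> n" and G: "G \<in> graph_class n k d"
  shows "graph_spectral_radius G < graph_spectral_radius (B_graph n (d + 1) k) \<or>
    graph_spectral_radius G \<le> graph_spectral_radius (B_graph n (d + 1) k) \<and>
    graph_iso G (B_graph n (d + 1) k)"
proof -
  let ?m = "d + 1" and ?l = "graph_spectral_radius G + 1"
  have sg: "simple_graph G" and nG: "card (verts G) = n" and dG: "min_degree G = d"
    and kG: "edge_connectivity G = k"
    using G unfolding graph_class_def by auto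
  have fin: "finite (verts G)" using sg unfolding simple_graph_def by simp
  have mn: "k + 2 \<le> n - ?m" "?m + 2 \<le> n - ?m" using k n by auto
  show ?thesis
  proof (cases "?l < real n - real ?m")
    case True
    \<comment> \<open>Here the clique of order \<open>n - m\<close> in \<open>B\<close> suffices: the form is positive at the point \<open>(0, 1)\<close>.\<close>
    let ?N = "real n - real ?m"
    have N: "real k + 2 \<le> ?N" using mn by linarith
    then have "(real k + 2)\<^sup>2 \<le> ?N\<^sup>2" by (intro power_mono) auto
    moreover have "(real k + 2)\<^sup>2 > k" by (simp add: power2_eq_square algebra_simps add_pos_nonneg)
    ultimately have Nsq: "?N\<^sup>2 > k" by linarith
    then have "(real k)\<^sup>2 / (?N\<^sup>2 - k) > 0" using k by (intro divide_pos_pos) auto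
    then have "secular n ?m k ?N < 0"
      using secular_form(2)[OF mn k(1), of ?N 0 1] by simp
    then have "?N - 1 < graph_spectral_radius (B_graph n ?m k)"
      using N Nsq k n by (intro B_graph_spectral_radius_secular(2)) auto
    then show ?thesis using True by linarith
  next
    case False
    then have l: "real n - real ?m \<le> ?l" by simp
    have "2 \<le> card (verts G)" using nG n by simp
    then obtain S T where ST: "verts G = S \<union> T" "S \<inter> T = {}" "S \<noteq> {}" "T \<noteq> {}"
        "card (cross G S T) = k"
      using edge_connectivity_cut[OF sg] kG by metis
    then have TS: "verts G = T \<union> S" "T \<inter> S = {}" "card (cross G T S) = k"
      using converse_cross[of G S T] card_inverse[of "cross G S T"] by auto
    have side: "?m \<le> card S" "?m \<le> card T"
      using small_cut_side_large[OF sg ST(1,2,3)] small_cut_side_large[OF sg TS(1,2) ST(4)]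
        ST(5) TS(3) dG k by auto
    have "verts G \<noteq> {}" using ST by auto
    then obtain x where x: "\<And>v. x v \<ge> 0" "\<exists>v\<in>verts G. x v \<noteq> 0"
      "\<And>v. v \<in> verts G \<Longrightarrow> graph_spectral_radius G * x v \<le> (\<Sum>w\<in>neighbours G v. x w)"
      using graph_spectral_radius_subharmonic[OF fin] by metis
    have sub: "\<And>v. v \<in> verts G \<Longrightarrow> (?l - 1) * x v \<le> (\<Sum>w\<in>neighbours G v. x w)"
      using x(3) by simp
    have m1: "1 \<le> ?m" by simp
    show ?thesis
    proof (cases "sum x S \<le> sum x T")
      case True
      from spectral_radius_compare_ordered[OF sg ST(1,2) nG ST(5) k(1) m1 side(1) mn x(1,2) sub l True]
      show ?thesis by simp
    next
      case False
      then have "sum x T \<le> sum x S" by simp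
      from spectral_radius_compare_ordered[OF sg TS(1,2) nG TS(3) k(1) m1 side(2) mn x(1,2) sub l this]
      show ?thesis by simp
    qed
  qed
qed

theorem theorem1p3:
  fixes n \<kappa> \<delta> :: nat and G :: "'a sgraph"
  assumes "4 \<le> \<kappa>" and "\<kappa> < \<delta>" and "n \<ge> 2 * \<delta> + 4"
    and "G \<in> graph_class n \<kappa> \<delta>"
  shows "graph_spectral_radius G \<le> graph_spectral_radius (B_graph n (\<delta> + 1) \<kappa>) \<and>
    (graph_spectral_radius G = graph_spectral_radius (B_graph n (\<delta> + 1) \<kappa>) \<longleftrightarrow>
      graph_iso G (B_graph n (\<delta> + 1) \<kappa>))"
proof -
  have "finite (verts G)" using assms(4) by (simp add: graph_class_def simple_graph_def)
  then have "graph_iso G (B_graph n (\<delta> + 1) \<kappa>) \<Longrightarrow>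
      graph_spectral_radius G = graph_spectral_radius (B_graph n (\<delta> + 1) \<kappa>)"
    by (rule graph_iso_spectral_radius)
  then show ?thesis
    using spectral_radius_compare[of \<kappa> \<delta> n G] assms by fastforce
qed

end
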